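(* Let $N\ge1$ be an integer, $c>0$, let $a<0<b$ be integers and $\mathcal{E}=\{a-N+1,\dots,a-1,a\}\cup\{b,b+1,\dots,b+N-1\}$. The pseudo-distribution of $(\sigma_{ab},S_{ab})$ is characterized by the following identity, valid for any $z\in(0,1)$ and any $\ell\in\mathcal{E}$: $$\mathbb{E}\!\left(z^{\sigma_{ab}}1_{\{S_{ab}=\ell,\ \sigma_{ab}<+\infty\}}\right)=\frac{W_\ell(u_1(z),\dots,u_{2N}(z))}{W(u_1(z),\dots,u_{2N}(z))},$$ where $W(u_1,\dots,u_{2N})$ is the $2N\times2N$ determinant whose $i$th row is $$\big(1,\;u_i,\;\dots,\;u_i^{N-1},\;u_i^{b-a+N-1},\;u_i^{b-a+N},\;\dots,\;u_i^{b-a+2N-2}\big),\qquad 1\le i\le 2N,$$ and, for $\ell\in\mathcal{E}$ (both when $a-N+1\le\ell\le a$ and when $b\le\ell\le b+N-1$), $W_\ell(u_1,\dots,u_{2N})$ is the determinant obtained from $W(u_1,\dots,u_{2N})$ by replacing the column $\big(u_i^{\ell+N-a-1}\big)_{1\le i\le2N}$ by the column $\big(u_i^{N-a-1}\big)_{1\le i\le2N}$.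
   Context: Pseudo-random walk: put $p_k=\delta_{k0}+(-1)^{k-1}c\binom{2N}{k+N}$ for $k\in\{-N,\dots,N\}$ (real numbers, possibly negative, summing to $1$). The $U_n$, $n\ge1$, are independent identically distributed pseudo-random variables (measurable functions on a space endowed with a signed measure of total mass one) with $\mathbb{P}\{U_n=k\}=p_k$, so that $\mathbb{P}\{U_1=k_1,\dots,U_n=k_n\}=p_{k_1}\cdots p_{k_n}$; $S_0=0$, $S_n=U_1+\dots+U_n$. First exit time: $\sigma_{ab}=\min\{n\ge1:S_n\le a\text{ or }S_n\ge b\}$ ($\min\emptyset=+\infty$), and, when $\sigma_{ab}<+\infty$, $S_{ab}=S_{\sigma_{ab}}\in\mathcal{E}$; $\mathbb{P}\{\sigma_{ab}=k,S_{ab}=\ell\}=\mathbb{P}\{S_1\in(a,b),\dots,S_{k-1}\in(a,b),S_k=\ell\}$ for $k\ge1$. Generating function: $\mathbb{E}\big(z^{\sigma_{ab}}1_{\{S_{ab}=\ell,\sigma_{ab}<+\infty\}}\big)=\sum_{k\ge1}\mathbb{P}\{\sigma_{ab}=k,S_{ab}=\ell\}z^k$. Roots: for $z\in(0,1)$ and $1\le j\le N$, let $\theta_j=-\mathrm{e}^{\mathrm{i}\frac{2j-1}{N}\pi}$ and $w(z)=\frac12\sqrt[N]{1-z}\,/\sqrt[N]{cz}$. The equation $u^2-2[1+\theta_jw(z)]u+1=0$ has two mutually inverse roots, exactly one of which has modulus $<1$; it is denoted $u_j(z)$, and one sets $u_{j+N}(z)=1/u_j(z)$ for $1\le j\le N$.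 Thus $u_1(z),\dots,u_{2N}(z)$ are the $2N$ roots of the polynomial $(1-z)u^N-(-1)^{N-1}cz(u-1)^{2N}$.
   Formalization: For large c the series defining the expectation may diverge in (0,1) (N=1, a=-1, b=1, c=10); the identity is proved wherever it converges (for all z in (0,1) if c ≤ 1/2^(2N-1)), otherwise for its analytic continuation along [0,z], in which sense it also characterizes the law. *)

theory Defs
  imports "HOL-Complex_Analysis.Complex_Analysis" "Jordan_Normal_Form.Determinant"
begin

definition step_weight :: "nat \<Rightarrow> real \<Rightarrow> int \<Rightarrow> real" where
  "step_weight N c k =
     (if k = 0 then 1 else 0) + (- 1) powi (k - 1) * c * real ((2 * N) choose nat (k + int N))"

text \<open>
  The weights are signed and the sum of their absolute values may exceed 1, in which case no
  countably additive real-valued measure carries the whole infinite sequence of steps. So the signed measure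
  of total mass one is only required to be finitely additive, on an algebra of events; every
  event used below depends on finitely many steps. The variable \<open>U 0\<close> is not used.
\<close>

locale pseudo_random_walk = Sigma_Algebra.algebra \<Omega> \<A>
  for \<Omega> :: "'w set" and \<A> :: "'w set set" +
  fixes P :: "'w set \<Rightarrow> real" and U :: "nat \<Rightarrow> 'w \<Rightarrow> int" and N :: nat and c :: real
  assumes finitely_additive: "Measure_Space.additive \<A> P"
    and total_mass: "P \<Omega> = 1"
    and step_range: "\<And>n \<omega>. 1 \<le> n \<Longrightarrow> \<omega> \<in> \<Omega> \<Longrightarrow> U n \<omega> \<in> {- int N..int N}"
    and step_measurable: "\<And>n k. 1 \<le> n \<Longrightarrow> {\<omega> \<in> \<Omega>. U n \<omega> = k} \<in> \<A>"
    and step_law: "\<And>n k. 1 \<le> n \<Longrightarrow> k \<in> {- int N..int N} \<Longrightarrow>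
                     P {\<omega> \<in> \<Omega>. U n \<omega> = k} = step_weight N c k"
    and independent: "\<And>n (k :: nat \<Rightarrow> int).
                     P {\<omega> \<in> \<Omega>. \<forall>i\<in>{1..n}. U i \<omega> = k i} = (\<Prod>i = 1..n. P {\<omega> \<in> \<Omega>. U i \<omega> = k i})"

definition walk :: "(nat \<Rightarrow> 'w \<Rightarrow> int) \<Rightarrow> nat \<Rightarrow> 'w \<Rightarrow> int" where
  "walk U n \<omega> = (\<Sum>i = 1..n. U i \<omega>)"

definition exit_time :: "(nat \<Rightarrow> 'w \<Rightarrow> int) \<Rightarrow> int \<Rightarrow> int \<Rightarrow> 'w \<Rightarrow> enat" where
  "exit_time U a b \<omega> = Inf {enat n | n. 1 \<le> n \<and> (walk U n \<omega> \<le> a \<or> b \<le> walk U n \<omega>)}"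

text \<open>Only meaningful when the exit time is finite.\<close>

definition exit_place :: "(nat \<Rightarrow> 'w \<Rightarrow> int) \<Rightarrow> int \<Rightarrow> int \<Rightarrow> 'w \<Rightarrow> int" where
  "exit_place U a b \<omega> = walk U (the_enat (exit_time U a b \<omega>)) \<omega>"

definition exit_set :: "nat \<Rightarrow> int \<Rightarrow> int \<Rightarrow> int set" where
  "exit_set N a b = {a - int N + 1..a} \<union> {b..b + int N - 1}"

definition exit_prob ::
  "'w set \<Rightarrow> ('w set \<Rightarrow> real) \<Rightarrow> (nat \<Rightarrow> 'w \<Rightarrow> int) \<Rightarrow> int \<Rightarrow> int \<Rightarrow> int \<Rightarrow> nat \<Rightarrow> real" where
  "exit_prob \<Omega> P U a b l k =
     P {\<omega> \<in> \<Omega>. exit_time U a b \<omega> = enat k \<and> exit_place U a b \<omega> = l}"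

text \<open>
  The generating function is the series of \<open>q k * z ^ k\<close> over \<open>k \<ge> 1\<close>. Its radius of convergence
  is positive but may be less than 1: for \<open>N = 1\<close>, \<open>a = - 1\<close>, \<open>b = 1\<close> the coefficients are
  \<open>c * (1 - 2 * c) ^ (k - 1)\<close>. For arbitrary \<open>c\<close> its value at a point of the unit interval is
  therefore taken in the sense of analytic continuation from 0 along the real segment; by the
  identity theorem there is at most one such value, and by Abel's theorem it is the sum of the
  series whenever the series converges.
\<close>

definition continued_sum :: "(nat \<Rightarrow> real) \<Rightarrow> real \<Rightarrow> complex \<Rightarrow> bool" where
  "continued_sum q z v \<longleftrightarrow>
     (\<exists>D G. open D \<and> connected D \<and> closed_segment 0 (complex_of_real z) \<subseteq> D \<and> G holomorphic_on D \<and>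
        (\<forall>\<^sub>F s in nhds 0. (\<lambda>k. complex_of_real (q (Suc k)) * s ^ Suc k) sums G s) \<and>
        G (complex_of_real z) = v)"

definition \<theta> :: "nat \<Rightarrow> nat \<Rightarrow> complex" where
  "\<theta> N j = - exp (\<i> * complex_of_real ((2 * real j - 1) / real N * pi))"

definition root_scale :: "nat \<Rightarrow> real \<Rightarrow> real \<Rightarrow> real" where
  "root_scale N c z = 1 / 2 * root N (1 - z) / root N (c * z)"

text \<open>The indices \<open>j\<close> run from 1 to \<open>2 * N\<close>.\<close>

definition inner_root :: "nat \<Rightarrow> real \<Rightarrow> real \<Rightarrow> nat \<Rightarrow> complex" where
  "inner_root N c z j =
     (THE u. u\<^sup>2 - 2 * (1 + \<theta> N j * complex_of_real (root_scale N c z)) * u + 1 = 0 \<and> cmod u < 1)"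

definition char_root :: "nat \<Rightarrow> real \<Rightarrow> real \<Rightarrow> nat \<Rightarrow> complex" where
  "char_root N c z j = (if j \<le> N then inner_root N c z j else 1 / inner_root N c z (j - N))"

text \<open>Matrix rows and columns are numbered from 0, so row \<open>i\<close> belongs to \<open>u (i + 1)\<close>.\<close>

definition col_exponent :: "nat \<Rightarrow> int \<Rightarrow> int \<Rightarrow> nat \<Rightarrow> int" where
  "col_exponent N a b j = (if j < N then int j else b - a + int N - 1 + (int j - int N))"

definition W_det :: "nat \<Rightarrow> int \<Rightarrow> int \<Rightarrow> (nat \<Rightarrow> complex) \<Rightarrow> complex" where
  "W_det N a b u =
     Determinant.det (Matrix.mat (2 * N) (2 * N) (\<lambda>(i, j). u (i + 1) ^ nat (col_exponent N a b j)))"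

definition W_det_repl :: "nat \<Rightarrow> int \<Rightarrow> int \<Rightarrow> int \<Rightarrow> (nat \<Rightarrow> complex) \<Rightarrow> complex" where
  "W_det_repl N a b l u =
     Determinant.det (Matrix.mat (2 * N) (2 * N) (\<lambda>(i, j).
       if col_exponent N a b j = l + int N - a - 1
       then u (i + 1) ^ nat (int N - a - 1)
       else u (i + 1) ^ nat (col_exponent N a b j)))"

end

theory Submission
  imports Defs
begin

text \<open>
  Let \<open>I = {a<..<b}\<close>, and let \<open>M n x\<close> be the signed probability that the walk stays in \<open>I\<close> up to time
  \<open>n - 1\<close> and is at \<open>x\<close> at time \<open>n\<close>. Decomposing over the last step gives
  \<open>M (n + 1) y = (\<Sum>x\<in>I. p (y - x) * M n x)\<close>, where \<open>p\<close> is the law of a step. So the Green function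
  \<open>h x = (\<Sum>n. M n x * s ^ n)\<close> solves a finite linear system \<open>h = \<delta>\<^sub>0 + s * K h\<close> on \<open>I\<close>, and by Cramer's rule
  it is a quotient of polynomials in \<open>s\<close> (\<open>linear_system_cramer\<close>). The exit probabilities have the
  generating function \<open>G l = s * (\<Sum>x\<in>I. p (l - x) * h x)\<close>, which is therefore rational, and the rational
  function is its analytic continuation wherever the determinant of \<open>1 - s K\<close> does not vanish.

  The determinant has no zero in \<open>[0, 1)\<close>, because the kernel is an energy form in disguise. The weights
  \<open>(- 1) ^ k * binomial (2 N) (k + N)\<close> are those of \<open>D\<^sup>* ^ N D ^ N\<close> for the difference operator \<open>D\<close>, so that
  \<open>\<langle>f, K f\<rangle> = \<parallel>f\<parallel>\<^sup>2 - c * \<parallel>D ^ N f\<parallel>\<^sup>2\<close> (\<open>killed_kernel_energy\<close>). Hence no \<open>f \<noteq> 0\<close> satisfies \<open>f = s * K f\<close>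
  with \<open>0 \<le> s < 1\<close>. Since \<open>\<parallel>D f\<parallel> \<le> 2 * \<parallel>f\<parallel>\<close>, the form also lies above \<open>- \<parallel>f\<parallel>\<^sup>2\<close> once \<open>c * 4 ^ N \<le> 2\<close>; then
  the whole open unit disc is free of zeros and the power series converges there.

  The identity for the value is optional stopping. If \<open>s * (\<Sum>k. p k * u ^ k) = 1\<close>, then \<open>s ^ n * u ^ S\<^sub>n\<close>
  has constant expectation, and stopping it at the exit time gives \<open>(\<Sum>l\<in>E. u ^ l * G l) = 1\<close>
  (\<open>exit_place_balance\<close>). The \<open>2 N\<close> characteristic roots all satisfy the hypothesis at \<open>s = z\<close>, and there
  are \<open>2 N\<close> unknowns \<open>G l\<close>. After multiplication by \<open>u ^ (N - a - 1)\<close> the matrix of this system is the one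
  whose determinant is \<open>W\<close>, and Cramer's rule yields \<open>G l = W\<^sub>l / W\<close> (\<open>W_det_repl_eq\<close>).

  That \<open>W \<noteq> 0\<close> again follows from the absence of eigenfunctions (\<open>W_det_nonzero\<close>). A linear relation between
  the rows is a combination \<open>x \<mapsto> (\<Sum>i. w i * u i ^ x)\<close> vanishing on the exit places; it satisfies
  \<open>f = z * K f\<close> on \<open>I\<close>, hence vanishes there too. It then has \<open>2 N\<close> consecutive zeros, and a Vandermonde
  argument with distinct \<open>u i\<close> makes it trivial.

  Finally, the continued values determine the coefficients by the identity theorem, since for small \<open>z\<close> they
  are the sums of the series themselves (\<open>continued_sum_determines_coefficients\<close>).
\<close>

section \<open>Finite linear systems depending polynomially on a parameter\<close>

lemma poly_det_entrywise:
  fixes A :: "'a::comm_ring_1 poly mat"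
  shows "poly (Determinant.det A) s = Determinant.det (map_mat (\<lambda>p. poly p s) A)"
proof -
  interpret comm_ring_hom "\<lambda>p. poly p s"
    by unfold_locales auto
  show ?thesis by (rule hom_det [symmetric])
qed

text \<open>
  Cramer's rule for \<open>h = e + s * \<kappa> h\<close>, carried out on matrices of polynomials in \<open>s\<close>, so that one pair \<open>d\<close>,
  \<open>Y\<close> serves all values of the parameter at once: \<open>d\<close> is the determinant of the system and \<open>Y x\<close> that of the
  system with the column of \<open>x\<close> replaced. In the second conclusion \<open>d\<close> may vanish, which is why it is stated
  as a product.
\<close>

lemma linear_system_cramer:
  fixes \<kappa> :: "'a \<Rightarrow> 'a \<Rightarrow> complex" and e :: "'a \<Rightarrow> complex"
  assumes "finite I"
  obtains d :: "complex poly" and Y :: "'a \<Rightarrow> complex poly" where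
    "\<And>s. poly d s = 0 \<Longrightarrow> \<exists>f. (\<exists>x\<in>I. f x \<noteq> 0) \<and> (\<forall>x\<in>I. f x = s * (\<Sum>y\<in>I. \<kappa> x y * f y))"
    "\<And>s h. \<forall>x\<in>I. h x = e x + s * (\<Sum>y\<in>I. \<kappa> x y * h y) \<Longrightarrow> \<forall>x\<in>I. h x * poly d s = poly (Y x) s"
    "\<And>s. poly d s \<noteq> 0 \<Longrightarrow>
       \<forall>x\<in>I. poly (Y x) s / poly d s = e x + s * (\<Sum>y\<in>I. \<kappa> x y * (poly (Y y) s / poly d s))"
proof -
  define n where "n = card I"
  obtain \<beta> where \<beta>: "bij_betw \<beta> {0..<n} I"
    using ex_bij_betw_nat_finite[OF assms] n_def by blast
  define \<gamma> where "\<gamma> = inv_into {0..<n} \<beta>"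
  have \<gamma>: "\<gamma> x < n" "\<beta> (\<gamma> x) = x" if "x \<in> I" for x
  proof -
    have "x \<in> \<beta> ` {0..<n}" using \<beta> that by (simp add: bij_betw_def)
    thus "\<gamma> x < n" "\<beta> (\<gamma> x) = x"
      unfolding \<gamma>_def using inv_into_into[of x \<beta> "{0..<n}"] by (auto simp: f_inv_into_f)
  qed
  have \<beta>I: "\<beta> i \<in> I" and \<gamma>\<beta>: "\<gamma> (\<beta> i) = i" if "i < n" for i
    using \<beta> that unfolding bij_betw_def \<gamma>_def by (auto simp: inv_into_f_f)
  have sumI: "(\<Sum>y\<in>I. g y) = (\<Sum>j<n. g (\<beta> j))" for g :: "'a \<Rightarrow> complex"
    using sum.reindex_bij_betw[OF \<beta>, of g] by (simp add: atLeast0LessThan)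
  define A :: "complex poly mat" where
    "A = Matrix.mat n n (\<lambda>(i,j). [: (if i = j then 1 else 0), - \<kappa> (\<beta> i) (\<beta> j) :])"
  define As :: "complex \<Rightarrow> complex mat" where
    "As s = Matrix.mat n n (\<lambda>(i,j). (if i = j then 1 else 0) - s * \<kappa> (\<beta> i) (\<beta> j))" for s
  define E where "E = Matrix.vec n (\<lambda>i. e (\<beta> i))"
  define d where "d = Determinant.det A"
  define Y where "Y x = Determinant.det (replace_col A (Matrix.vec n (\<lambda>i. [: e (\<beta> i) :])) (\<gamma> x))" for x
  have As: "As s \<in> carrier_mat n n" for s by (simp add: As_def)
  have d: "poly d s = Determinant.det (As s)" for s
    unfolding d_def poly_det_entrywise
    by (rule arg_cong[where f = Determinant.det]) (rule eq_matI, auto simp: A_def As_def)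
  have Y: "poly (Y x) s = Determinant.det (replace_col (As s) E (\<gamma> x))" for s x
    unfolding Y_def poly_det_entrywise
    by (rule arg_cong[where f = Determinant.det])
       (rule eq_matI, auto simp: A_def As_def E_def replace_col_def)
  have mult: "(As s *\<^sub>v Matrix.vec n (\<lambda>j. h (\<beta> j))) = Matrix.vec n (\<lambda>i. h (\<beta> i) - s * (\<Sum>y\<in>I. \<kappa> (\<beta> i) y * h y))"
    for s h
  proof (rule eq_vecI)
    fix i assume "i < dim_vec (Matrix.vec n (\<lambda>i. h (\<beta> i) - s * (\<Sum>y\<in>I. \<kappa> (\<beta> i) y * h y)))"
    hence i: "i < n" by simp
    have "vec_index (As s *\<^sub>v Matrix.vec n (\<lambda>j. h (\<beta> j))) i
        = (\<Sum>j<n. ((if i = j then 1 else 0) - s * \<kappa> (\<beta> i) (\<beta> j)) * h (\<beta> j))"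
      using i by (simp add: As_def scalar_prod_def atLeast0LessThan)
    also have "\<dots> = (\<Sum>j<n. (if i = j then h (\<beta> j) else 0) - s * (\<kappa> (\<beta> i) (\<beta> j) * h (\<beta> j)))"
      by (rule sum.cong) (auto simp: algebra_simps)
    also have "\<dots> = h (\<beta> i) - s * (\<Sum>j<n. \<kappa> (\<beta> i) (\<beta> j) * h (\<beta> j))"
      using i by (simp add: sum_subtractf sum_distrib_left)
    finally show "vec_index (As s *\<^sub>v Matrix.vec n (\<lambda>j. h (\<beta> j))) i =
        vec_index (Matrix.vec n (\<lambda>i. h (\<beta> i) - s * (\<Sum>y\<in>I. \<kappa> (\<beta> i) y * h y))) i"
      using i by (simp add: sumI)
  qed (simp add: As_def)
  have vec_of: "v = Matrix.vec n (\<lambda>j. (\<lambda>x. vec_index v (\<gamma> x)) (\<beta> j))" if "v \<in> carrier_vec n" for v :: "complex vec"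
    using that by (intro eq_vecI) (auto simp: \<gamma>\<beta>)
  have 2: "\<forall>x\<in>I. h x * poly d s = poly (Y x) s"
    if h: "\<forall>x\<in>I. h x = e x + s * (\<Sum>y\<in>I. \<kappa> x y * h y)" for s h
  proof
    fix x assume x: "x \<in> I"
    have "As s *\<^sub>v Matrix.vec n (\<lambda>j. h (\<beta> j)) = E"
      unfolding mult E_def
    proof (rule eq_vecI)
      fix i assume "i < dim_vec (Matrix.vec n (\<lambda>i. e (\<beta> i)))"
      hence i: "i < n" by simp
      from h \<beta>I[OF i] have "h (\<beta> i) = e (\<beta> i) + s * (\<Sum>y\<in>I. \<kappa> (\<beta> i) y * h y)" by blast
      thus "vec_index (Matrix.vec n (\<lambda>i. h (\<beta> i) - s * (\<Sum>y\<in>I. \<kappa> (\<beta> i) y * h y))) i = vec_index (Matrix.vec n (\<lambda>i. e (\<beta> i))) i"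
        using i by (metis (no_types, lifting) add_diff_cancel_right' index_vec)
    qed simp
    with cramer_lemma_mat[OF As _ \<gamma>(1)[OF x], of "Matrix.vec n (\<lambda>j. h (\<beta> j))" s]
    show "h x * poly d s = poly (Y x) s" using \<gamma>[OF x] by (simp add: d Y)
  qed
  have 1: "\<exists>f. (\<exists>x\<in>I. f x \<noteq> 0) \<and> (\<forall>x\<in>I. f x = s * (\<Sum>y\<in>I. \<kappa> x y * f y))" if "poly d s = 0" for s
  proof -
    from that obtain v where v: "v \<in> carrier_vec n" "v \<noteq> 0\<^sub>v n" "As s *\<^sub>v v = 0\<^sub>v n"
      using det_0_iff_vec_prod_zero_field[OF As] d by auto
    define f where "f x = vec_index v (\<gamma> x)" for x
    have vf: "v = Matrix.vec n (\<lambda>j. f (\<beta> j))" using vec_of[OF v(1)] by (simp add: f_def)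
    have "\<exists>x\<in>I. f x \<noteq> 0"
    proof (rule ccontr)
      assume "\<not> ?thesis"
      hence "v = 0\<^sub>v n" by (subst vf, intro eq_vecI) (auto simp: \<beta>I)
      with v show False by simp
    qed
    moreover have "f x = s * (\<Sum>y\<in>I. \<kappa> x y * f y)" if x: "x \<in> I" for x
    proof -
      have "vec_index (As s *\<^sub>v v) (\<gamma> x) = 0" using v \<gamma>[OF x] by simp
      thus ?thesis unfolding vf mult using \<gamma>[OF x] by simp
    qed
    ultimately show ?thesis by blast
  qed
  have 3: "\<forall>x\<in>I. poly (Y x) s / poly d s = e x + s * (\<Sum>y\<in>I. \<kappa> x y * (poly (Y y) s / poly d s))"
    if nz: "poly d s \<noteq> 0" for s
  proof -
    \<comment> \<open>The adjugate provides a solution, and the second conclusion identifies it.\<close>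
    define v where "v = adj_mat (As s) *\<^sub>v ((1 / poly d s) \<cdot>\<^sub>v E)"
    have v: "v \<in> carrier_vec n"
      using adj_mat(1)[OF As, of s] by (simp add: v_def E_def)
    have "As s *\<^sub>v v = (As s * adj_mat (As s)) *\<^sub>v ((1 / poly d s) \<cdot>\<^sub>v E)"
      unfolding v_def by (rule assoc_mult_mat_vec[symmetric, OF As adj_mat(1)[OF As]]) (simp add: E_def)
    also have "\<dots> = poly d s \<cdot>\<^sub>v (1\<^sub>m n *\<^sub>v ((1 / poly d s) \<cdot>\<^sub>v E))"
      unfolding adj_mat(2)[OF As] d
      by (rule eq_vecI) (auto simp: E_def)
    also have "\<dots> = E" using nz by (auto simp: E_def intro!: eq_vecI)
    finally have Av: "As s *\<^sub>v v = E" .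
    define f where "f x = vec_index v (\<gamma> x)" for x
    have vf: "v = Matrix.vec n (\<lambda>j. f (\<beta> j))" using vec_of[OF v(1)] by (simp add: f_def)
    have f: "\<forall>x\<in>I. f x = e x + s * (\<Sum>y\<in>I. \<kappa> x y * f y)"
    proof
      fix x assume x: "x \<in> I"
      have "vec_index (As s *\<^sub>v v) (\<gamma> x) = e x" using Av \<gamma>[OF x] by (simp add: E_def)
      thus "f x = e x + s * (\<Sum>y\<in>I. \<kappa> x y * f y)" unfolding vf mult using \<gamma>[OF x]
        by (simp add: algebra_simps)
    qed
    from 2[OF f] nz have fY: "\<forall>x\<in>I. poly (Y x) s / poly d s = f x"
      by (metis nonzero_mult_div_cancel_right)
    have "(\<Sum>y\<in>I. \<kappa> x y * (poly (Y y) s / poly d s)) = (\<Sum>y\<in>I. \<kappa> x y * f y)" for x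
      using fY by (intro sum.cong) auto
    with f fY show ?thesis by (metis (no_types, lifting))
  qed
  show thesis using that[of d Y] 1 2 3 by blast
qed

section \<open>Power series and analytic continuation\<close>

text \<open>
  Passing to formal power series makes two things available: coefficients are unique, and products with
  polynomials can be formed without any discussion of convergence.
\<close>

lemma has_fps_expansion_of_eventually_sums:
  fixes a :: "nat \<Rightarrow> complex"
  assumes "\<forall>\<^sub>F s in nhds 0. (\<lambda>k. a k * s ^ k) sums g s"
  shows "g has_fps_expansion Abs_fps a"
proof -
  from assms obtain r where r: "r > 0" "\<And>s. norm s < r \<Longrightarrow> (\<lambda>k. a k * s ^ k) sums g s"
    unfolding eventually_nhds_metric by (auto simp: dist_norm)
  have "conv_radius a \<ge> ereal r"
  proof (rule conv_radius_geI_ex')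
    fix r' assume "r' > 0" "ereal r' < ereal r"
    thus "summable (\<lambda>n. a n * of_real r' ^ n)"
      using r(2)[of "of_real r'"] by (auto simp: sums_iff)
  qed
  hence "fps_conv_radius (Abs_fps a) \<ge> ereal r" by (simp add: fps_conv_radius_def)
  moreover have "ereal 0 < ereal r" using r by simp
  ultimately have "fps_conv_radius (Abs_fps a) > 0" by (metis order_less_le_trans zero_ereal_def)
  moreover have "\<forall>\<^sub>F z in nhds 0. eval_fps (Abs_fps a) z = g z"
    using assms by eventually_elim (auto simp: eval_fps_def sums_iff)
  ultimately show ?thesis by (simp add: has_fps_expansion_def)
qed

text \<open>
  The series \<open>A\<close> may converge only conditionally at \<open>z\<close>, so a general Cauchy product is out of reach; but
  multiplication by a polynomial is a finite combination of shifts.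
\<close>

lemma sums_fps_mult_poly:
  fixes A :: "complex fps"
  assumes "(\<lambda>n. fps_nth A n * z ^ n) sums S"
  shows "(\<lambda>n. fps_nth (fps_of_poly d * A) n * z ^ n) sums (poly d z * S)"
proof (induction d)
  case 0
  then show ?case by simp
next
  case (pCons c d)
  have eq: "fps_of_poly (pCons c d) * A = fps_const c * A + fps_X * (fps_of_poly d * A)"
    unfolding fps_of_poly_pCons by (simp add: algebra_simps)
  have nth: "fps_nth (fps_X * B) (Suc n) = fps_nth B n" for B :: "complex fps" and n
    by simp
  have "(\<lambda>n. fps_nth (fps_X * (fps_of_poly d * A)) (Suc n) * z ^ (Suc n)) sums (z * (poly d z * S))"
    using sums_mult[OF pCons.IH, of z] unfolding nth by (simp add: mult_ac)
  hence "(\<lambda>n. fps_nth (fps_X * (fps_of_poly d * A)) n * z ^ n) sums (z * (poly d z * S))"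
    by (subst (asm) sums_Suc_iff) simp
  from sums_add[OF sums_mult[OF assms, of c] this]
  show ?case unfolding eq by (simp add: algebra_simps)
qed

text \<open>
  At a point \<open>z\<close> on the boundary of the disc of convergence the sum and the rational function are compared
  by clearing the denominator: the coefficients of \<open>d\<close> times the series are those of \<open>p\<close>, by uniqueness of
  expansions at 0, and the sum at \<open>z\<close> is multiplicative for a polynomial factor.
\<close>

lemma suminf_eq_rational_value:
  fixes a :: "nat \<Rightarrow> complex" and p d :: "complex poly"
  assumes "\<forall>\<^sub>F s in nhds 0. (\<lambda>k. a k * s ^ k) sums (poly p s / poly d s)"
    and "poly d 0 \<noteq> 0" "poly d z \<noteq> 0" "summable (\<lambda>k. a k * z ^ k)"
  shows "(\<Sum>k. a k * z ^ k) = poly p z / poly d z"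
proof -
  have 1: "(\<lambda>s. poly p s / poly d s) has_fps_expansion Abs_fps a"
    by (rule has_fps_expansion_of_eventually_sums[OF assms(1)])
  have d: "poly d has_fps_expansion fps_of_poly d" and p: "poly p has_fps_expansion fps_of_poly p"
    by (auto simp: has_fps_expansion_def)
  have "(\<lambda>s. poly d s * (poly p s / poly d s)) has_fps_expansion (fps_of_poly d * Abs_fps a)"
    by (rule has_fps_expansion_mult[OF d 1])
  moreover have ev: "\<forall>\<^sub>F s in nhds 0. poly d s * (poly p s / poly d s) = poly p s"
  proof -
    have "open {s. poly d s \<noteq> 0}" by (intro open_Collect_neq continuous_intros)
    from eventually_nhds_in_open[OF this, of 0] assms(2) show ?thesis
      by (auto elim: eventually_mono)
  qed
  ultimately have "poly p has_fps_expansion (fps_of_poly d * Abs_fps a)"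
    using has_fps_expansion_cong[OF ev refl] by blast
  with p have eq: "fps_of_poly d * Abs_fps a = fps_of_poly p"
    using fps_expansion_unique_complex by blast
  have "(\<lambda>n. fps_nth (Abs_fps a) n * z ^ n) sums (\<Sum>k. a k * z ^ k)"
    using assms(4) by (simp add: summable_sums)
  from sums_fps_mult_poly[OF this, of d]
  have "(\<lambda>n. coeff p n * z ^ n) sums (poly d z * (\<Sum>k. a k * z ^ k))"
    unfolding eq by simp
  moreover have "(\<lambda>n. coeff p n * z ^ n) sums poly p z"
    unfolding poly_altdef by (rule sums_finite) (auto simp: coeff_eq_0)
  ultimately have "poly d z * (\<Sum>k. a k * z ^ k) = poly p z"
    by (rule sums_unique2)
  thus ?thesis using assms(3) by (simp add: field_simps)
qed

lemma summable_of_holomorphic_ball: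
  fixes a :: "nat \<Rightarrow> complex"
  assumes "\<forall>\<^sub>F s in nhds 0. (\<lambda>k. a k * s ^ k) sums g s" "g holomorphic_on ball 0 r" "norm z < r"
  shows "summable (\<lambda>k. a k * z ^ k)"
proof -
  have "r > 0" using assms(3) norm_ge_zero[of z] by linarith
  hence "g has_fps_expansion fps_expansion g 0"
    using assms(2) by (intro has_fps_expansion_fps_expansion[of "ball 0 r"]) auto
  with has_fps_expansion_of_eventually_sums[OF assms(1)] have "Abs_fps a = fps_expansion g 0"
    using fps_expansion_unique_complex by blast
  moreover have "fps_conv_radius (fps_expansion g 0) \<ge> ereal r"
    using assms(2) by (intro conv_radius_fps_expansion) (simp only: eball_ereal)
  ultimately have "conv_radius a \<ge> ereal r"
    by (metis fps_conv_radius_def fps_nth_Abs_fps ext)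
  with assms(3) have "ereal (norm z) < conv_radius a"
    by (meson ereal_less_eq(3) less_ereal.simps(1) order_less_le_trans)
  thus ?thesis by (rule summable_in_conv_radius)
qed

text \<open>
  The intersection of the two domains may be disconnected, but its component containing 0 contains the whole
  segment, and on that component the identity theorem applies.
\<close>

lemma continued_sum_unique:
  assumes "continued_sum q z v" "continued_sum q z v'"
  shows "v = v'"
proof -
  from assms(1) obtain D G where 1: "open D" "closed_segment 0 (of_real z) \<subseteq> D" "G holomorphic_on D"
      "\<forall>\<^sub>F s in nhds 0. (\<lambda>k. of_real (q (Suc k)) * s ^ Suc k) sums G s" "G (of_real z) = v"
    unfolding continued_sum_def by auto
  from assms(2) obtain D' G' where 2: "open D'" "closed_segment 0 (of_real z) \<subseteq> D'" "G' holomorphic_on D'"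
      "\<forall>\<^sub>F s in nhds 0. (\<lambda>k. of_real (q (Suc k)) * s ^ Suc k) sums G' s" "G' (of_real z) = v'"
    unfolding continued_sum_def by auto
  define C where "C = connected_component_set (D \<inter> D') 0"
  have C: "open C" "connected C" "C \<subseteq> D \<inter> D'"
    unfolding C_def using 1 2 by (auto intro: open_connected_component dest: connected_component_in)
  have seg: "closed_segment 0 (complex_of_real z) \<subseteq> C"
    unfolding C_def using 1 2 by (intro connected_component_maximal) auto
  hence 0: "0 \<in> C" and z: "complex_of_real z \<in> C" by auto
  from 1(4) 2(4) have "\<forall>\<^sub>F s in nhds 0. G s - G' s = 0"
    by eventually_elim (metis right_minus_eq sums_unique2)
  then obtain U where U: "open U" "0 \<in> U" "\<And>s. s \<in> U \<Longrightarrow> G s - G' s = 0"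
    unfolding eventually_nhds by blast
  have lim: "0 islimpt (U \<inter> C)" using U(1,2) C(1) 0 by (intro interior_limit_point) (auto simp: interior_open)
  have "G holomorphic_on C" "G' holomorphic_on C"
    using C 1(3) 2(3) by (auto intro: holomorphic_on_subset)
  hence "(\<lambda>s. G s - G' s) holomorphic_on C" by (rule holomorphic_on_diff)
  from analytic_continuation[OF this C(1,2) _ 0 lim _ z] U(3)
  have "G (of_real z) - G' (of_real z) = 0" by blast
  thus ?thesis using 1 2 by simp
qed

text \<open>
  On a disc around 0 inside its domain, every continuation serves as a continuation to all small positive
  points; this is how values at different points \<open>z\<close>, each with a domain of its own, are compared.
\<close>

lemma continued_sum_near_0:
  assumes "continued_sum q z v"
  obtains r g where "r > 0" "g holomorphic_on ball 0 r" 
    "\<forall>\<^sub>F s in nhds 0. (\<lambda>k. of_real (q (Suc k)) * s ^ Suc k) sums g s"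
    "\<And>t. 0 < t \<Longrightarrow> t < r \<Longrightarrow> continued_sum q t (g (of_real t))"
proof -
  from assms obtain D G where 1: "open D" "closed_segment 0 (of_real z) \<subseteq> D" "G holomorphic_on D"
      "\<forall>\<^sub>F s in nhds 0. (\<lambda>k. of_real (q (Suc k)) * s ^ Suc k) sums G s"
    unfolding continued_sum_def by auto
  have "0 \<in> D" using 1 by auto
  with 1(1) obtain r where r: "r > 0" "ball 0 r \<subseteq> D" by (meson openE)
  have hol: "G holomorphic_on ball 0 r" using 1(3) r(2) by (rule holomorphic_on_subset)
  have "continued_sum q t (G (of_real t))" if "0 < t" "t < r" for t
    unfolding continued_sum_def
    using 1(4) hol r that
    by (intro exI[of _ "ball 0 r"] exI[of _ G]) (auto simp: closed_segment_subset)
  with r hol 1(4) that show thesis by blast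
qed

text \<open>
  For small \<open>t > 0\<close> both series have the sum \<open>v t\<close>. These points accumulate at 0, so the two analytic
  functions agree near 0 and have the same coefficients.
\<close>

lemma continued_sum_determines_coefficients:
  assumes "\<And>z. z \<in> {0<..<1} \<Longrightarrow> continued_sum q z (v z)"
    and "\<And>z. z \<in> {0<..<1} \<Longrightarrow> continued_sum q' z (v z)" and "k \<ge> 1"
  shows "q k = q' k"
proof -
  have half: "1/2 \<in> {0<..<1::real}" by simp
  obtain r g where g: "r > 0" "g holomorphic_on ball 0 r" 
    "\<forall>\<^sub>F s in nhds 0. (\<lambda>k. of_real (q (Suc k)) * s ^ Suc k) sums g s"
    "\<And>t. 0 < t \<Longrightarrow> t < r \<Longrightarrow> continued_sum q t (g (of_real t))"
    using continued_sum_near_0[OF assms(1)[OF half]] by blast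
  obtain r' g' where g': "r' > 0" "g' holomorphic_on ball 0 r'" 
    "\<forall>\<^sub>F s in nhds 0. (\<lambda>k. of_real (q' (Suc k)) * s ^ Suc k) sums g' s"
    "\<And>t. 0 < t \<Longrightarrow> t < r' \<Longrightarrow> continued_sum q' t (g' (of_real t))"
    using continued_sum_near_0[OF assms(2)[OF half]] by blast
  define \<rho> where "\<rho> = Min {r, r', 1}"
  have \<rho>: "\<rho> > 0" "\<rho> \<le> r" "\<rho> \<le> r'" "\<rho> \<le> 1" using g(1) g'(1) by (auto simp: \<rho>_def)
  have eq: "g (of_real t) - g' (of_real t) = 0" if "0 < t" "t < \<rho>" for t
  proof -
    have "g (of_real t) = v t"
      using continued_sum_unique[OF g(4) assms(1)] that \<rho> by auto
    moreover have "g' (of_real t) = v t"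
      using continued_sum_unique[OF g'(4) assms(2)] that \<rho> by auto
    ultimately show ?thesis by simp
  qed
  have lim: "0 islimpt (complex_of_real ` {0<..<\<rho>})"
    unfolding islimpt_approachable
  proof safe
    fix e :: real assume "e > 0"
    define t where "t = min e \<rho> / 2"
    have "0 < t" "t < \<rho>" "t < e" using \<open>e > 0\<close> \<rho> by (auto simp: t_def)
    thus "\<exists>x'\<in>complex_of_real ` {0<..<\<rho>}. x' \<noteq> 0 \<and> dist x' 0 < e"
      by (intro bexI[of _ "complex_of_real t"]) auto
  qed
  have "g w - g' w = 0" if "w \<in> ball 0 \<rho>" for w
  proof (rule analytic_continuation[of "\<lambda>w. g w - g' w" "ball 0 \<rho>" "complex_of_real ` {0<..<\<rho>}" 0])
    show "(\<lambda>w. g w - g' w) holomorphic_on ball 0 \<rho>"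
      using g(2) g'(2) \<rho> by (auto intro!: holomorphic_intros intro: holomorphic_on_subset)
  qed (use \<rho> that lim eq in auto)
  hence "\<forall>\<^sub>F w in nhds 0. g w = g' w"
    using \<rho>(1) by (intro eventually_nhds_in_open[THEN eventually_mono, of "ball 0 \<rho>"]) auto
  with g(3) have 2: "\<forall>\<^sub>F s in nhds 0. (\<lambda>k. complex_of_real (q (Suc k)) * s ^ Suc k) sums g' s"
    by eventually_elim simp
  \<comment> \<open>The series start at exponent 1, so the value at index 0 is replaced by 0.\<close>
  define a where "a q n = (if n = 0 then 0 else complex_of_real (q n))" for q :: "nat \<Rightarrow> real" and n
  have shift: "(\<lambda>k. a q k * s ^ k) sums w" if "(\<lambda>k. complex_of_real (q (Suc k)) * s ^ Suc k) sums w" for q s w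
    using sums_Suc_iff[of "\<lambda>k. a q k * s ^ k" w] that by (simp add: a_def)
  have "g' has_fps_expansion Abs_fps (a q)"
    by (rule has_fps_expansion_of_eventually_sums) (use 2 shift in \<open>auto elim: eventually_mono\<close>)
  moreover have "g' has_fps_expansion Abs_fps (a q')"
    by (rule has_fps_expansion_of_eventually_sums) (use g'(3) shift in \<open>auto elim: eventually_mono\<close>)
  ultimately have "Abs_fps (a q) = Abs_fps (a q')"
    by (rule fps_expansion_unique_complex)
  hence "a q k = a q' k" by (metis fps_nth_Abs_fps)
  thus ?thesis using assms(3) by (simp add: a_def)
qed

section \<open>The jump kernel and its energy form\<close>

text \<open>
  For \<open>k < - N\<close> the argument \<open>nat (k + N)\<close> in \<open>step_weight\<close> is 0, which yields a binomial coefficient 1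
  where the law of a step must vanish. The kernel is evaluated at arbitrary differences of two points of the
  interval, hence the cut-off.
\<close>

definition jump :: "nat \<Rightarrow> real \<Rightarrow> int \<Rightarrow> real" where
  "jump N c k = (if \<bar>k\<bar> \<le> int N then step_weight N c k else 0)"

lemma jump_outside: "\<bar>k\<bar> > int N \<Longrightarrow> jump N c k = 0"
  by (simp add: jump_def)

lemma jump_of_diff:
  assumes "j \<le> 2 * N"
  shows "jump N c (int N - int j) = (if j = N then 1 else 0) - c * (-1) ^ (N + j) * real ((2 * N) choose j)"
proof -
  have "\<bar>int N - int j\<bar> \<le> int N" using assms by auto
  moreover have "nat (int N - int j + int N) = 2 * N - j" using assms by auto
  moreover have "(2 * N) choose (2 * N - j) = (2 * N) choose j"
    using assms by (rule binomial_symmetric[symmetric])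
  moreover have "(-1 :: real) powi (int N - int j - 1) = - ((-1) ^ (N + j))"
  proof (cases "even (N + j)")
    case True
    hence "odd (int N - int j - 1)" by presburger
    thus ?thesis using True by (simp add: power_int_minus_left)
  next
    case False
    hence "even (int N - int j - 1)" by presburger
    thus ?thesis using False by (simp add: power_int_minus_left)
  qed
  ultimately show ?thesis by (auto simp: jump_def step_weight_def)
qed

lemma bij_betw_reflected_range:
  "bij_betw (\<lambda>j. int N - int j) {..2 * N} {- int N..int N}"
  by (rule bij_betwI[of _ _ _ "\<lambda>k. nat (int N - k)"]) auto

lemma jump_uminus: "jump N c (- k) = jump N c k"
proof (cases "\<bar>k\<bar> \<le> int N")
  case True
  define j where "j = nat (int N - k)"
  have j: "j \<le> 2 * N" "int N - int j = k" "int N - int (2 * N - j) = - k" "2 * N - j \<le> 2 * N"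
    using True by (auto simp: j_def)
  have "even (N + (2 * N - j)) = even (N + j)" using j(1) by auto
  hence sgn: "(-1 :: real) ^ (N + (2 * N - j)) = (-1) ^ (N + j)"
    by (metis neg_one_even_power neg_one_odd_power)
  have "2 * N - j = N \<longleftrightarrow> j = N" using j(1) by auto
  with jump_of_diff[OF j(4), of c] jump_of_diff[OF j(1), of c] sgn binomial_symmetric[OF j(1)]
  show ?thesis unfolding j(2,3) by (simp add: mult.assoc)
qed (simp add: jump_def)

text \<open>
  The law of a step is the unit mass at 0 minus \<open>c * (- 1) ^ N\<close> times the coefficients of a central
  difference of order \<open>2 N\<close>. Everything about the kernel is read off from this form.
\<close>

lemma jump_sum:
  fixes f :: "int \<Rightarrow> complex"
  shows "(\<Sum>k\<in>{- int N..int N}. of_real (jump N c k) * f k)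
    = f 0 - of_real c * ((-1) ^ N * (\<Sum>j\<le>2 * N. (-1) ^ j * of_nat ((2 * N) choose j) * f (int N - int j)))"
proof -
  have "(\<Sum>k\<in>{- int N..int N}. of_real (jump N c k) * f k)
      = (\<Sum>j\<le>2 * N. of_real (jump N c (int N - int j)) * f (int N - int j))"
    by (rule sum.reindex_bij_betw[OF bij_betw_reflected_range, symmetric])
  also have "\<dots> = (\<Sum>j\<le>2 * N. (if j = N then f (int N - int j) else 0)
      - of_real c * ((-1) ^ N * ((-1) ^ j * of_nat ((2 * N) choose j) * f (int N - int j))))"
    by (intro sum.cong refl) (simp add: jump_of_diff power_add algebra_simps)
  also have "\<dots> = f 0 - of_real c * ((-1) ^ N * (\<Sum>j\<le>2 * N. (-1) ^ j * of_nat ((2 * N) choose j) * f (int N - int j)))"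
    by (simp add: sum_subtractf sum_distrib_left)
  finally show ?thesis .
qed

text \<open>
  Exponentials are eigenfunctions of differences, with eigenvalue \<open>(u - 1) ^ (2 * N) / u ^ N\<close> for the
  central one.
\<close>

lemma jump_symbol:
  fixes u :: complex
  assumes "u \<noteq> 0"
  shows "(\<Sum>k\<in>{- int N..int N}. of_real (jump N c k) * u powi k)
    = 1 - of_real c * ((-1) ^ N * ((u - 1) ^ (2 * N) / u ^ N))"
proof -
  have "(u - 1) ^ (2 * N) = (\<Sum>j\<le>2 * N. of_nat ((2 * N) choose j) * (-1) ^ j * u ^ (2 * N - j))"
    using binomial_ring[of "-1" u "2 * N"] by simp
  also have "\<dots> = (\<Sum>j\<le>2 * N. (-1) ^ j * of_nat ((2 * N) choose j) * u powi (int N - int j)) * u ^ N"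
    unfolding sum_distrib_right
  proof (intro sum.cong refl)
    fix j assume "j \<in> {..2 * N}"
    hence "u ^ (2 * N - j) = u powi (int N - int j + int N)"
      by (simp flip: power_int_of_nat add: of_nat_diff)
    also have "\<dots> = u powi (int N - int j) * u ^ N"
      using assms by (subst power_int_add) auto
    finally show "of_nat ((2 * N) choose j) * (-1) ^ j * u ^ (2 * N - j)
        = (-1) ^ j * of_nat ((2 * N) choose j) * u powi (int N - int j) * u ^ N" by simp
  qed
  finally show ?thesis using assms by (simp add: jump_sum)
qed

definition backward_diff :: "(int \<Rightarrow> complex) \<Rightarrow> int \<Rightarrow> complex" where
  "backward_diff f x = f x - f (x - 1)"

text \<open>
  The sign makes this the adjoint of \<open>backward_diff\<close>.
\<close>

definition forward_diff :: "(int \<Rightarrow> complex) \<Rightarrow> int \<Rightarrow> complex" where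
  "forward_diff f x = f x - f (x + 1)"

lemma backward_diff_funpow:
  "(backward_diff ^^ n) f x = (\<Sum>j\<le>n. (-1) ^ j * of_nat (n choose j) * f (x - int j))"
proof (induction n arbitrary: x)
  case (Suc n)
  have "(\<Sum>j\<le>Suc n. (-1) ^ j * of_nat (Suc n choose j) * f (x - int j))
      = f x + (\<Sum>j\<le>n. (-1) ^ Suc j * of_nat (Suc n choose Suc j) * f (x - int (Suc j)))"
    by (subst sum.atMost_Suc_shift) simp
  also have "(\<Sum>j\<le>n. (-1) ^ Suc j * of_nat (Suc n choose Suc j) * f (x - int (Suc j)))
      = (\<Sum>j\<le>n. (-1) ^ Suc j * of_nat (n choose Suc j) * f (x - int (Suc j)))
        - (\<Sum>j\<le>n. (-1) ^ j * of_nat (n choose j) * f (x - 1 - int j))"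
    unfolding sum_subtractf[symmetric] by (intro sum.cong refl) (simp add: algebra_simps)
  also have "f x + ((\<Sum>j\<le>n. (-1) ^ Suc j * of_nat (n choose Suc j) * f (x - int (Suc j)))
        - (\<Sum>j\<le>n. (-1) ^ j * of_nat (n choose j) * f (x - 1 - int j)))
      = (\<Sum>j\<le>Suc n. (-1) ^ j * of_nat (n choose j) * f (x - int j))
        - (\<Sum>j\<le>n. (-1) ^ j * of_nat (n choose j) * f (x - 1 - int j))"
    by (subst sum.atMost_Suc_shift[of _ n]) simp
  also have "\<dots> = (backward_diff ^^ n) f x - (backward_diff ^^ n) f (x - 1)"
    by (simp add: Suc)
  finally show ?case by (simp only: funpow.simps o_apply backward_diff_def[of "(backward_diff ^^ n) f"])
qed simp

lemma forward_diff_funpow: "(forward_diff ^^ n) g x = (-1) ^ n * (backward_diff ^^ n) g (x + int n)"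
  by (induction n arbitrary: x) (auto simp: forward_diff_def backward_diff_def algebra_simps)

lemma backward_diff_vanishes:
  assumes "\<And>x. x \<notin> {l..r} \<Longrightarrow> f x = 0" "x \<notin> {l..r + 1}"
  shows "backward_diff f x = 0"
  using assms(2) by (auto simp: backward_diff_def assms(1))

lemma summation_by_parts:
  assumes "\<And>x. x \<notin> {l..r} \<Longrightarrow> f x = 0"
  shows "(\<Sum>x\<in>{l..r + 1}. cnj (backward_diff f x) * g x) = (\<Sum>x\<in>{l..r}. cnj (f x) * forward_diff g x)"
proof -
  have 1: "(\<Sum>x\<in>{l..r + 1}. cnj (f x) * g x) = (\<Sum>x\<in>{l..r}. cnj (f x) * g x)"
    by (rule sum.mono_neutral_right) (auto simp: assms)
  have "(\<Sum>x\<in>{l..r + 1}. cnj (f (x - 1)) * g x) = (\<Sum>x\<in>{l - 1..r}. cnj (f x) * g (x + 1))"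
    by (rule sum.reindex_bij_witness[of _ "\<lambda>x. x + 1" "\<lambda>x. x - 1"]) auto
  also have "\<dots> = (\<Sum>x\<in>{l..r}. cnj (f x) * g (x + 1))"
    by (rule sum.mono_neutral_right) (auto simp: assms)
  finally have 2: "(\<Sum>x\<in>{l..r + 1}. cnj (f (x - 1)) * g x) = (\<Sum>x\<in>{l..r}. cnj (f x) * g (x + 1))" .
  have "(\<Sum>x\<in>{l..r + 1}. cnj (backward_diff f x) * g x)
      = (\<Sum>x\<in>{l..r + 1}. cnj (f x) * g x) - (\<Sum>x\<in>{l..r + 1}. cnj (f (x - 1)) * g x)"
    by (simp add: backward_diff_def algebra_simps sum_subtractf)
  thus ?thesis unfolding 1 2 by (simp add: forward_diff_def algebra_simps sum_subtractf)
qed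

text \<open>
  Each backward difference widens the support by one point on the right, hence the enlarged range of
  summation.
\<close>

lemma summation_by_parts_funpow:
  assumes "\<And>x. x \<notin> {l..r} \<Longrightarrow> f x = 0"
  shows "(\<Sum>x\<in>{l..r + int n}. cnj ((backward_diff ^^ n) f x) * g x) = (\<Sum>x\<in>{l..r}. cnj (f x) * (forward_diff ^^ n) g x)"
  using assms
proof (induction n arbitrary: f r)
  case (Suc n)
  have "(\<Sum>x\<in>{l..r + 1 + int n}. cnj ((backward_diff ^^ n) (backward_diff f) x) * g x)
      = (\<Sum>x\<in>{l..r + 1}. cnj (backward_diff f x) * (forward_diff ^^ n) g x)"
    by (rule Suc.IH) (rule backward_diff_vanishes[OF Suc.prems])
  also have "\<dots> = (\<Sum>x\<in>{l..r}. cnj (f x) * forward_diff ((forward_diff ^^ n) g) x)"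
    by (rule summation_by_parts[OF Suc.prems])
  finally show ?case by (simp add: funpow_swap1 add.assoc)
qed simp

text \<open>
  The parallelogram inequality \<open>\<bar>p - q\<bar>\<^sup>2 \<le> 2 * \<bar>p\<bar>\<^sup>2 + 2 * \<bar>q\<bar>\<^sup>2\<close>, summed over all points.
\<close>

lemma backward_diff_norm_bound:
  assumes "\<And>x. x \<notin> {l..r} \<Longrightarrow> f x = 0"
  shows "(\<Sum>x\<in>{l..r + 1}. (cmod (backward_diff f x))\<^sup>2) \<le> 4 * (\<Sum>x\<in>{l..r}. (cmod (f x))\<^sup>2)"
proof -
  have 1: "(\<Sum>x\<in>{l..r + 1}. (cmod (f x))\<^sup>2) = (\<Sum>x\<in>{l..r}. (cmod (f x))\<^sup>2)"
    by (rule sum.mono_neutral_right) (auto simp: assms)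
  have "(\<Sum>x\<in>{l..r + 1}. (cmod (f (x - 1)))\<^sup>2) = (\<Sum>x\<in>{l - 1..r}. (cmod (f x))\<^sup>2)"
    by (rule sum.reindex_bij_witness[of _ "\<lambda>x. x + 1" "\<lambda>x. x - 1"]) auto
  also have "\<dots> = (\<Sum>x\<in>{l..r}. (cmod (f x))\<^sup>2)"
    by (rule sum.mono_neutral_right) (auto simp: assms)
  finally have 2: "(\<Sum>x\<in>{l..r + 1}. (cmod (f (x - 1)))\<^sup>2) = (\<Sum>x\<in>{l..r}. (cmod (f x))\<^sup>2)" .
  have "(cmod (backward_diff f x))\<^sup>2 \<le> 2 * (cmod (f x))\<^sup>2 + 2 * (cmod (f (x - 1)))\<^sup>2" for x
  proof -
    have "(cmod (backward_diff f x))\<^sup>2 \<le> (cmod (f x) + cmod (f (x - 1)))\<^sup>2"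
      unfolding backward_diff_def by (intro power_mono norm_triangle_ineq4) simp
    also have "\<dots> \<le> 2 * (cmod (f x))\<^sup>2 + 2 * (cmod (f (x - 1)))\<^sup>2"
      using sum_squares_bound[of "cmod (f x)" "cmod (f (x - 1))"] by (simp add: power2_sum)
    finally show ?thesis .
  qed
  hence "(\<Sum>x\<in>{l..r + 1}. (cmod (backward_diff f x))\<^sup>2)
      \<le> (\<Sum>x\<in>{l..r + 1}. 2 * (cmod (f x))\<^sup>2 + 2 * (cmod (f (x - 1)))\<^sup>2)"
    by (intro sum_mono)
  also have "\<dots> = 2 * (\<Sum>x\<in>{l..r}. (cmod (f x))\<^sup>2) + 2 * (\<Sum>x\<in>{l..r}. (cmod (f x))\<^sup>2)"
    unfolding sum.distrib sum_distrib_left[symmetric] 1 2 ..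
  finally show ?thesis by simp
qed

lemma backward_diff_funpow_norm_bound:
  assumes "\<And>x. x \<notin> {l..r} \<Longrightarrow> f x = 0"
  shows "(\<Sum>x\<in>{l..r + int n}. (cmod ((backward_diff ^^ n) f x))\<^sup>2) \<le> 4 ^ n * (\<Sum>x\<in>{l..r}. (cmod (f x))\<^sup>2)"
  using assms
proof (induction n arbitrary: f r)
  case (Suc n)
  have "(\<Sum>x\<in>{l..r + 1 + int n}. (cmod ((backward_diff ^^ n) (backward_diff f) x))\<^sup>2)
      \<le> 4 ^ n * (\<Sum>x\<in>{l..r + 1}. (cmod (backward_diff f x))\<^sup>2)"
    by (rule Suc.IH) (rule backward_diff_vanishes[OF Suc.prems])
  also have "\<dots> \<le> 4 ^ n * (4 * (\<Sum>x\<in>{l..r}. (cmod (f x))\<^sup>2))"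
    by (intro mult_left_mono backward_diff_norm_bound[OF Suc.prems]) auto
  finally show ?case by (simp add: funpow_swap1 add.assoc)
qed simp

text \<open>
  Here \<open>Q\<close> is the squared norm of the \<open>N\<close>-th difference of \<open>f\<close>. The kernel is the identity minus \<open>c\<close> times
  the \<open>N\<close>-th forward difference of the \<open>N\<close>-th backward difference, and summation by parts moves the forward
  one to the other factor.
\<close>

lemma killed_kernel_energy:
  fixes f :: "int \<Rightarrow> complex"
  assumes "\<And>x. x \<notin> {a<..<b} \<Longrightarrow> f x = 0"
  obtains Q where "0 \<le> Q" "Q \<le> 4 ^ N * (\<Sum>x\<in>{a<..<b}. (cmod (f x))\<^sup>2)"
    "(\<Sum>x\<in>{a<..<b}. cnj (f x) * (\<Sum>y\<in>{a<..<b}. of_real (jump N c (y - x)) * f y))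
      = of_real ((\<Sum>x\<in>{a<..<b}. (cmod (f x))\<^sup>2) - c * Q)"
proof -
  have I: "{a<..<b} = {a + 1..b - 1}" by auto
  have van: "f x = 0" if "x \<notin> {a + 1..b - 1}" for x using assms that unfolding I by blast
  define Q where "Q = (\<Sum>x\<in>{a + 1..b - 1 + int N}. (cmod ((backward_diff ^^ N) f x))\<^sup>2)"
  have conv: "(\<Sum>y\<in>{a<..<b}. of_real (jump N c (y - x)) * f y) = f x - of_real c * (forward_diff ^^ N) ((backward_diff ^^ N) f) x" for x
  proof -
    have "(\<Sum>y\<in>{a<..<b}. of_real (jump N c (y - x)) * f y)
        = (\<Sum>y\<in>{a<..<b} \<inter> {x - int N..x + int N}. of_real (jump N c (y - x)) * f y)"
      by (rule sum.mono_neutral_right) (auto intro!: jump_outside)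
    also have "\<dots> = (\<Sum>y\<in>{x - int N..x + int N}. of_real (jump N c (y - x)) * f y)"
      by (rule sum.mono_neutral_left) (auto intro!: assms)
    also have "\<dots> = (\<Sum>k\<in>{- int N..int N}. of_real (jump N c k) * f (x + k))"
      by (rule sum.reindex_bij_witness[of _ "\<lambda>k. x + k" "\<lambda>y. y - x"]) auto
    also have "\<dots> = f x - of_real c * ((-1) ^ N * (backward_diff ^^ (2 * N)) f (x + int N))"
      unfolding jump_sum backward_diff_funpow by (simp add: algebra_simps)
    also have "(-1) ^ N * (backward_diff ^^ (2 * N)) f (x + int N) = (forward_diff ^^ N) ((backward_diff ^^ N) f) x"
      unfolding forward_diff_funpow by (simp add: mult_2 funpow_add)
    finally show ?thesis .
  qed
  have sq: "cnj z * z = of_real ((cmod z)\<^sup>2)" for z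
    by (metis complex_norm_square mult.commute of_real_power)
  have "(\<Sum>x\<in>{a<..<b}. cnj (f x) * (forward_diff ^^ N) ((backward_diff ^^ N) f) x)
      = (\<Sum>x\<in>{a + 1..b - 1 + int N}. cnj ((backward_diff ^^ N) f x) * (backward_diff ^^ N) f x)"
    unfolding I by (rule summation_by_parts_funpow[OF van, symmetric])
  also have "\<dots> = of_real Q" unfolding Q_def by (simp only: sq of_real_sum)
  finally have "(\<Sum>x\<in>{a<..<b}. cnj (f x) * (forward_diff ^^ N) ((backward_diff ^^ N) f) x) = of_real Q" .
  moreover have "(\<Sum>x\<in>{a<..<b}. cnj (f x) * f x) = of_real (\<Sum>x\<in>{a<..<b}. (cmod (f x))\<^sup>2)"
    by (simp only: sq of_real_sum)
  ultimately have "(\<Sum>x\<in>{a<..<b}. cnj (f x) * (\<Sum>y\<in>{a<..<b}. of_real (jump N c (y - x)) * f y))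
      = of_real ((\<Sum>x\<in>{a<..<b}. (cmod (f x))\<^sup>2) - c * Q)"
    unfolding conv by (simp add: right_diff_distrib sum_subtractf mult.left_commute sum_distrib_left[symmetric])
  moreover have "0 \<le> Q" unfolding Q_def by (intro sum_nonneg) simp
  moreover have "Q \<le> 4 ^ N * (\<Sum>x\<in>{a<..<b}. (cmod (f x))\<^sup>2)"
    unfolding Q_def I by (rule backward_diff_funpow_norm_bound[OF van])
  ultimately show thesis using that by blast
qed

text \<open>
  Pairing the equation with \<open>f\<close> gives \<open>S = s * (S - c * Q)\<close> for the squared norm \<open>S\<close> of \<open>f\<close>. For \<open>0 \<le> s < 1\<close>
  the right side is at most \<open>s * S\<close>. When \<open>c * 4 ^ N \<le> 2\<close>, the bound on \<open>Q\<close> gives \<open>\<bar>S - c * Q\<bar> \<le> S\<close>, so a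
  complex \<open>s\<close> of modulus less than 1 is excluded too.
\<close>

lemma killed_kernel_no_eigenfunction:
  fixes f :: "int \<Rightarrow> complex"
  assumes eig: "\<And>x. x \<in> {a<..<b} \<Longrightarrow> f x = s * (\<Sum>y\<in>{a<..<b}. of_real (jump N c (y - x)) * f y)"
    and c: "0 < c"
    and s: "(\<exists>t. 0 \<le> t \<and> t < 1 \<and> s = of_real t) \<or> (cmod s < 1 \<and> c * 4 ^ N \<le> 2)"
    and x: "x \<in> {a<..<b}"
  shows "f x = 0"
proof -
  \<comment> \<open>The hypotheses say nothing about \<open>f\<close> off the interval, but the energy identity is about functions supported in it.\<close>
  define g where "g x = (if x \<in> {a<..<b} then f x else 0)" for x
  define S where "S = (\<Sum>x\<in>{a<..<b}. (cmod (g x))\<^sup>2)"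
  have van: "g x = 0" if "x \<notin> {a<..<b}" for x using that by (simp only: g_def if_False)
  obtain Q where Q: "0 \<le> Q" "Q \<le> 4 ^ N * S"
    "(\<Sum>x\<in>{a<..<b}. cnj (g x) * (\<Sum>y\<in>{a<..<b}. of_real (jump N c (y - x)) * g y)) = of_real (S - c * Q)"
    using killed_kernel_energy[of a b g N c] van unfolding S_def by blast
  have g: "g x = s * (\<Sum>y\<in>{a<..<b}. of_real (jump N c (y - x)) * g y)" if "x \<in> {a<..<b}" for x
    using eig[OF that] that by (simp add: g_def)
  have "complex_of_real S = (\<Sum>x\<in>{a<..<b}. cnj (g x) * g x)"
    unfolding S_def of_real_sum by (intro sum.cong refl) (metis complex_norm_square mult.commute)
  also have "\<dots> = (\<Sum>x\<in>{a<..<b}. cnj (g x) * (s * (\<Sum>y\<in>{a<..<b}. of_real (jump N c (y - x)) * g y)))"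
    by (rule sum.cong) (use g in auto)
  also have "\<dots> = s * of_real (S - c * Q)"
    unfolding Q(3)[symmetric] by (simp add: sum_distrib_left mult.left_commute)
  finally have eq: "complex_of_real S = s * of_real (S - c * Q)" .
  have S0: "0 \<le> S" unfolding S_def by (intro sum_nonneg) simp
  have cQ: "0 \<le> c * Q" using c Q by simp
  have "S = 0" using s
  proof
    assume "\<exists>t. 0 \<le> t \<and> t < 1 \<and> s = of_real t"
    then obtain t where t: "0 \<le> t" "t < 1" "s = of_real t" by blast
    have "S = t * (S - c * Q)" using eq unfolding t(3) of_real_mult[symmetric] of_real_eq_iff .
    also have "\<dots> \<le> t * S" using t cQ by (intro mult_left_mono) auto
    finally have "(1 - t) * S \<le> 0" by (simp add: algebra_simps)
    thus ?thesis using t S0 by (simp add: mult_le_0_iff)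
  next
    assume s: "cmod s < 1 \<and> c * 4 ^ N \<le> 2"
    have "c * Q \<le> c * (4 ^ N * S)" using c Q by simp
    also have "\<dots> = c * 4 ^ N * S" by simp
    also have "\<dots> \<le> 2 * S" using s S0 by (intro mult_right_mono) auto
    finally have "\<bar>S - c * Q\<bar> \<le> S" using cQ by linarith
    have "cmod (of_real S) = cmod (s * of_real (S - c * Q))" using eq by simp
    hence "S = cmod s * \<bar>S - c * Q\<bar>" using S0 by (simp add: norm_mult del: of_real_diff of_real_mult)
    also have "\<dots> \<le> cmod s * S" by (intro mult_left_mono) (use \<open>\<bar>S - c * Q\<bar> \<le> S\<close> in auto)
    finally have "(1 - cmod s) * S \<le> 0" by (simp add: algebra_simps)
    thus ?thesis using s S0 by (simp add: mult_le_0_iff)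
  qed
  hence "g x = 0" using x unfolding S_def by (subst (asm) sum_nonneg_eq_0_iff) auto
  thus ?thesis using x by (simp add: g_def)
qed

section \<open>Characteristic roots\<close>

text \<open>
  For \<open>u \<noteq> 0\<close> this says \<open>(u + 1 / u) / 2 = 1 + v\<close>: the point \<open>u\<close> is a preimage of \<open>1 + v\<close> under the
  Joukowski map.
\<close>

definition joukowski :: "complex \<Rightarrow> complex \<Rightarrow> bool" where
  "joukowski v u \<longleftrightarrow> u\<^sup>2 - 2 * (1 + v) * u + 1 = 0"

lemma joukowski_nonzero: "joukowski v u \<Longrightarrow> u \<noteq> 0"
  by (auto simp: joukowski_def)

lemma joukowski_inverse: "joukowski v u \<Longrightarrow> joukowski v (1 / u)"
  using joukowski_nonzero[of v u] by (simp add: joukowski_def field_simps power2_eq_square) algebra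

lemma joukowski_shift: "joukowski v u \<Longrightarrow> (u - 1)\<^sup>2 = 2 * v * u"
  by (simp add: joukowski_def power2_eq_square algebra_simps)

lemma joukowski_parameter: "joukowski v u \<Longrightarrow> joukowski v' u \<Longrightarrow> v = v'"
proof -
  assume u: "joukowski v u" "joukowski v' u"
  hence "2 * v * u = 2 * v' * u" by (metis joukowski_shift)
  thus "v = v'" using joukowski_nonzero[OF u(1)] by simp
qed

lemma joukowski_two_roots: "joukowski v u \<Longrightarrow> joukowski v u' \<Longrightarrow> u = u' \<or> u * u' = 1"
proof -
  assume u: "joukowski v u" "joukowski v u'"
  have "(u - u') * (u * u' - 1)
      = u' * (u\<^sup>2 - 2 * (1 + v) * u + 1) - u * (u'\<^sup>2 - 2 * (1 + v) * u' + 1)"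
    by (simp add: power2_eq_square algebra_simps)
  hence "(u - u') * (u * u' - 1) = 0" using u by (simp add: joukowski_def)
  thus ?thesis by auto
qed

lemma joukowski_root_exists: "\<exists>u. joukowski v u"
proof -
  define r where "r = csqrt ((1 + v)\<^sup>2 - 1)"
  have "r\<^sup>2 = (1 + v)\<^sup>2 - 1" by (simp add: r_def)
  moreover have "(1 + v + r)\<^sup>2 - 2 * (1 + v) * (1 + v + r) + 1 = r\<^sup>2 - (1 + v)\<^sup>2 + 1"
    by (simp add: power2_eq_square algebra_simps)
  ultimately have "joukowski v (1 + v + r)" by (simp add: joukowski_def)
  thus ?thesis ..
qed

text \<open>
  On the unit circle \<open>1 / u\<close> is the conjugate of \<open>u\<close>, so \<open>1 + v\<close> is the real part of \<open>u\<close>.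
\<close>

lemma joukowski_unit_circle:
  assumes "joukowski v u" "cmod u = 1"
  obtains t where "t \<le> 0" "v = of_real t"
proof -
  have u: "u \<noteq> 0" using assms by auto
  have inv: "1 / u = cnj u" using assms(2) u
    by (metis complex_div_cnj divide_self_if mult_1 norm_one one_power2 div_by_1 of_real_1)
  have "2 * (1 + v) = u + 1 / u"
    using assms(1) u by (simp add: joukowski_def field_simps power2_eq_square)
  hence "2 * (1 + v) = 2 * of_real (Re u)" by (simp add: inv complex_add_cnj)
  hence "1 + v = of_real (Re u)" by (simp only: mult_cancel_left) simp
  hence "v = of_real (Re u - 1)" by (simp add: eq_diff_eq add.commute)
  moreover have "Re u - 1 \<le> 0" using complex_Re_le_cmod[of u] assms(2) by simp
  ultimately show thesis using that by blast
qed

text \<open>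
  The two roots have product 1 and neither has modulus 1, so exactly one of them lies inside the unit
  circle.
\<close>

lemma ex1_joukowski_inside:
  assumes "\<And>t. t \<le> 0 \<Longrightarrow> v \<noteq> complex_of_real t"
  shows "\<exists>!u. joukowski v u \<and> cmod u < 1"
proof -
  obtain u where u: "joukowski v u" using joukowski_root_exists by blast
  have ne: "cmod u \<noteq> 1" using joukowski_unit_circle[OF u] assms by metis
  have "\<exists>u. joukowski v u \<and> cmod u < 1"
  proof (cases "cmod u < 1")
    case False
    hence "1 < cmod u" using ne by linarith
    hence "cmod (1 / u) < 1" using joukowski_nonzero[OF u] by (simp add: norm_divide)
    thus ?thesis using joukowski_inverse[OF u] by blast
  qed (use u in blast)
  moreover have "u = u'" if "joukowski v u \<and> cmod u < 1" "joukowski v u' \<and> cmod u' < 1" for u u'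
  proof (rule ccontr)
    assume "u \<noteq> u'"
    hence "cmod u * cmod u' = 1" using joukowski_two_roots that by (metis norm_mult norm_one)
    moreover have "cmod u * cmod u' < 1 * 1" using that by (intro mult_strict_mono) auto
    ultimately show False by simp
  qed
  ultimately show ?thesis by blast
qed

lemma theta_power:
  assumes "1 \<le> N" "1 \<le> j"
  shows "\<theta> N j ^ N = - ((-1) ^ N)"
proof -
  have "exp (\<i> * complex_of_real ((2 * real j - 1) / real N * pi)) ^ N
      = exp (of_nat N * (\<i> * complex_of_real ((2 * real j - 1) / real N * pi)))"
    by (rule exp_of_nat_mult[symmetric])
  also have "of_nat N * (\<i> * complex_of_real ((2 * real j - 1) / real N * pi))
      = of_nat j * (2 * of_real pi * \<i>) - of_real pi * \<i>"
    using assms by (simp add: field_simps)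
  also have "exp \<dots> = -1"
    by (simp add: exp_diff exp_of_nat_mult mult.commute)
  finally have "(- \<theta> N j) ^ N = -1" by (simp add: \<theta>_def)
  thus ?thesis by (cases "even N") (auto simp: minus_equation_iff)
qed

text \<open>
  The arguments \<open>(2 * j - 1) / N * \<pi>\<close> for \<open>1 \<le> j \<le> N\<close> differ by less than \<open>2 * \<pi>\<close>.
\<close>

lemma theta_inj:
  assumes "1 \<le> N" "j \<in> {1..N}" "k \<in> {1..N}" "\<theta> N j = \<theta> N k"
  shows "j = k"
proof -
  let ?e = "\<lambda>j. \<i> * complex_of_real ((2 * real j - 1) / real N * pi)"
  have "\<bar>Im (?e j) - Im (?e k)\<bar> = 2 * pi * (\<bar>real j - real k\<bar> / real N)"
  proof -
    have "Im (?e j) - Im (?e k) = 2 * pi * ((real j - real k) / real N)"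
      using assms(1) by (simp add: field_simps)
    thus ?thesis by (simp add: abs_mult abs_divide)
  qed
  also have "\<bar>real j - real k\<bar> / real N < 1" using assms(1-3) by auto
  finally have "\<bar>Im (?e j) - Im (?e k)\<bar> < 2 * pi" by (simp add: mult_strict_left_mono)
  moreover have "exp (?e j) = exp (?e k)" using assms(4) by (simp add: \<theta>_def)
  ultimately have "?e j = ?e k" by (rule exp_complex_eqI)
  hence "(2 * real j - 1) / real N * pi = (2 * real k - 1) / real N * pi"
    by (simp only: mult_cancel_left of_real_eq_iff) auto
  thus ?thesis using assms(1) by simp
qed

lemma root_scale_pos:
  assumes "1 \<le> N" "0 < c" "0 < z" "z < 1"
  shows "root_scale N c z > 0" and "(2 * root_scale N c z) ^ N = (1 - z) / (c * z)"
  using assms by (auto simp: root_scale_def power_divide real_root_pow_pos2)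

text \<open>
  The parameter \<open>\<theta> N j * w\<close> with \<open>w > 0\<close> is never a nonpositive real number: its \<open>N\<close>-th power is
  \<open>- ((- 1) ^ N) * w ^ N\<close>, whereas \<open>t ^ N = (- 1) ^ N * \<bar>t\<bar> ^ N\<close> for \<open>t \<le> 0\<close>.
\<close>

lemma inner_root:
  assumes "1 \<le> N" "0 < c" "0 < z" "z < 1" "1 \<le> j"
  shows "joukowski (\<theta> N j * of_real (root_scale N c z)) (inner_root N c z j)"
    and "cmod (inner_root N c z j) < 1"
proof -
  define w where "w = root_scale N c z"
  have w: "w > 0" unfolding w_def by (rule root_scale_pos) fact+
  have "\<theta> N j * of_real w \<noteq> complex_of_real t" if "t \<le> 0" for t
  proof
    assume "\<theta> N j * of_real w = complex_of_real t"
    hence "of_real t ^ N = \<theta> N j ^ N * complex_of_real w ^ N" by (simp flip: power_mult_distrib)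
    hence "complex_of_real (t ^ N) = of_real (- ((-1) ^ N) * w ^ N)"
      using theta_power[OF assms(1,5)] by simp
    hence "(-1) ^ N * t ^ N = - ((-1) ^ N * (-1) ^ N * w ^ N)" by (simp only: of_real_eq_iff)
    hence "(- t) ^ N = - (w ^ N)" by (metis mult_1 mult_minus1 power_mult_distrib mult_minus_left minus_minus)
    moreover have "(- t) ^ N \<ge> 0" using that by simp
    moreover have "w ^ N > 0" using w by simp
    ultimately show False by linarith
  qed
  from theI'[OF ex1_joukowski_inside[OF this]]
  show "joukowski (\<theta> N j * of_real (root_scale N c z)) (inner_root N c z j)"
    "cmod (inner_root N c z j) < 1"
    unfolding inner_root_def w_def joukowski_def by blast+
qed

text \<open>
  Raising \<open>(u - 1)\<^sup>2 = 2 * v * u\<close> to the \<open>N\<close>-th power removes the dependence on \<open>j\<close> and gives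
  \<open>(u - 1) ^ (2 * N) / u ^ N = - ((- 1) ^ N) * (1 - z) / (c * z)\<close>, the characteristic equation.
\<close>

lemma joukowski_symbol:
  assumes "1 \<le> N" "0 < c" "0 < z" "z < 1" "1 \<le> j"
    and u: "joukowski (\<theta> N j * of_real (root_scale N c z)) u"
  shows "of_real z * (\<Sum>k\<in>{- int N..int N}. of_real (jump N c k) * u powi k) = 1"
proof -
  have u0: "u \<noteq> 0" by (rule joukowski_nonzero[OF u])
  have "(u - 1) ^ (2 * N) = ((u - 1)\<^sup>2) ^ N" by (simp add: power_mult)
  also have "\<dots> = (\<theta> N j * of_real (2 * root_scale N c z) * u) ^ N"
    unfolding joukowski_shift[OF u] by (simp add: mult_ac)
  also have "\<dots> = - ((-1) ^ N) * of_real ((2 * root_scale N c z) ^ N) * u ^ N"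
    unfolding power_mult_distrib theta_power[OF assms(1,5)] by (simp add: power_mult_distrib)
  also have "(2 * root_scale N c z) ^ N = (1 - z) / (c * z)"
    by (rule root_scale_pos) fact+
  finally have "(u - 1) ^ (2 * N) / u ^ N = - ((-1) ^ N) * of_real ((1 - z) / (c * z))"
    using u0 by simp
  hence "(\<Sum>k\<in>{- int N..int N}. of_real (jump N c k) * u powi k)
      = 1 + of_real c * ((-1) ^ N * (-1) ^ N * of_real ((1 - z) / (c * z)))"
    unfolding jump_symbol[OF u0] by simp
  also have "\<dots> = 1 + of_real c * of_real ((1 - z) / (c * z))"
    by (simp flip: power_mult_distrib)
  also have "\<dots> = of_real (1 / z)" using assms by (simp add: field_simps)
  finally show ?thesis using assms by simp
qed

lemma char_root_joukowski:
  assumes "1 \<le> N" "0 < c" "0 < z" "z < 1" "i \<in> {1..2 * N}"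
  shows "joukowski (\<theta> N (if i \<le> N then i else i - N) * of_real (root_scale N c z)) (char_root N c z i)"
  using assms inner_root(1)[OF assms(1-4)] 
  by (auto simp: char_root_def intro!: joukowski_inverse)

lemma char_root_nonzero:
  assumes "1 \<le> N" "0 < c" "0 < z" "z < 1" "i \<in> {1..2 * N}"
  shows "char_root N c z i \<noteq> 0"
  using joukowski_nonzero char_root_joukowski[OF assms] by blast

lemma char_root_symbol:
  assumes "1 \<le> N" "0 < c" "0 < z" "z < 1" "i \<in> {1..2 * N}"
  shows "of_real z * (\<Sum>k\<in>{- int N..int N}. of_real (jump N c k) * char_root N c z i powi k) = 1"
  by (rule joukowski_symbol[OF assms(1-4) _ char_root_joukowski[OF assms]]) (use assms in auto)

text \<open>
  A root determines its parameter \<open>\<theta> N j * w\<close> and hence \<open>j\<close>; the two roots with the same \<open>j\<close> lie on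
  different sides of the unit circle.
\<close>

lemma char_root_inj:
  assumes "1 \<le> N" "0 < c" "0 < z" "z < 1"
  shows "inj_on (char_root N c z) {1..2 * N}"
proof (rule inj_onI)
  fix i k assume ik: "i \<in> {1..2 * N}" "k \<in> {1..2 * N}" "char_root N c z i = char_root N c z k"
  define r where "r i = (if i \<le> N then i else i - N)" for i
  have "\<theta> N (r i) * of_real (root_scale N c z) = \<theta> N (r k) * of_real (root_scale N c z)"
    using joukowski_parameter char_root_joukowski[OF assms ik(1)] char_root_joukowski[OF assms ik(2)] ik(3)
    unfolding r_def by metis
  hence "\<theta> N (r i) = \<theta> N (r k)" using root_scale_pos(1)[OF assms] by simp
  hence r: "r i = r k" using ik by (intro theta_inj[OF assms(1)]) (auto simp: r_def)
  have out: "cmod (1 / inner_root N c z j) > 1" if "1 \<le> j" for j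
    using inner_root(2)[OF assms that] joukowski_nonzero[OF inner_root(1)[OF assms that]]
    by (simp add: norm_divide)
  have "(i \<le> N) = (k \<le> N)"
  proof (rule ccontr)
    assume "(i \<le> N) \<noteq> (k \<le> N)"
    then consider "i \<le> N" "N < k" | "k \<le> N" "N < i" by linarith
    thus False
    proof cases
      case 1
      hence "1 \<le> k - N" by simp
      from 1 ik inner_root(2)[OF assms, of i] out[OF this] show False by (simp add: char_root_def)
    next
      case 2
      hence "1 \<le> i - N" by simp
      from 2 ik inner_root(2)[OF assms, of k] out[OF this] show False by (simp add: char_root_def)
    qed
  qed
  with r ik show "i = k" by (auto simp: r_def split: if_splits)
qed

section \<open>Path probabilities and exit probabilities\<close>

text \<open>
  The position at time \<open>n\<close> is unconstrained. So one recursion covers both the paths inside the interval (\<open>y\<close>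
  in the interval) and the exits (\<open>y\<close> outside).
\<close>

definition interior_path :: "'w set \<Rightarrow> (nat \<Rightarrow> 'w \<Rightarrow> int) \<Rightarrow> int \<Rightarrow> int \<Rightarrow> nat \<Rightarrow> int \<Rightarrow> 'w set" where
  "interior_path \<Omega> U a b n y =
     {\<omega> \<in> \<Omega>. (\<forall>j\<in>{1..<n}. walk U j \<omega> \<in> {a<..<b}) \<and> walk U n \<omega> = y}"

context pseudo_random_walk
begin

lemma P_empty: "P {} = 0"
  using finitely_additive[unfolded additive_def, rule_format, of "{}" "{}"] by simp

lemma P_finite_UN:
  assumes "finite S" "\<And>i. i \<in> S \<Longrightarrow> F i \<in> \<A>" "disjoint_family_on F S"
  shows "(\<Union>i\<in>S. F i) \<in> \<A>" "P (\<Union>i\<in>S. F i) = (\<Sum>i\<in>S. P (F i))"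
proof -
  have "(\<Union>i\<in>S. F i) \<in> \<A> \<and> P (\<Union>i\<in>S. F i) = (\<Sum>i\<in>S. P (F i))"
    using assms
  proof (induction S rule: finite_induct)
    case (insert i S)
    have dis: "disjoint_family_on F S"
      using insert.prems(2) by (rule disjoint_family_on_mono[rotated]) auto
    have IH: "(\<Union>i\<in>S. F i) \<in> \<A>" "P (\<Union>i\<in>S. F i) = (\<Sum>i\<in>S. P (F i))"
      using insert.IH[OF _ dis] insert.prems(1) by auto
    have "F i \<inter> (\<Union>i\<in>S. F i) = {}"
      using insert.prems(2) insert.hyps(2) unfolding disjoint_family_on_def by fastforce
    with IH insert finitely_additive[unfolded additive_def, rule_format, of "F i" "\<Union>i\<in>S. F i"]
    show ?case by auto
  qed (simp add: P_empty)
  thus "(\<Union>i\<in>S. F i) \<in> \<A>" "P (\<Union>i\<in>S. F i) = (\<Sum>i\<in>S. P (F i))" by auto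
qed

lemma P_step:
  assumes "1 \<le> n"
  shows "P {\<omega> \<in> \<Omega>. U n \<omega> = k} = jump N c k"
proof (cases "k \<in> {- int N..int N}")
  case True
  thus ?thesis using step_law[OF assms True] by (auto simp: jump_def)
next
  case False
  hence "{\<omega> \<in> \<Omega>. U n \<omega> = k} = {}" using step_range[OF assms] by auto
  hence "P {\<omega> \<in> \<Omega>. U n \<omega> = k} = 0" by (simp only: P_empty)
  thus ?thesis using False by (auto simp: jump_def)
qed

lemma cylinder_measurable: "{\<omega> \<in> \<Omega>. \<forall>i\<in>{1..n}. U i \<omega> = k i} \<in> \<A>"
proof (induction n)
  case (Suc n)
  have "{\<omega> \<in> \<Omega>. \<forall>i\<in>{1..Suc n}. U i \<omega> = k i}
      = {\<omega> \<in> \<Omega>. \<forall>i\<in>{1..n}. U i \<omega> = k i} \<inter> {\<omega> \<in> \<Omega>. U (Suc n) \<omega> = k (Suc n)}"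
    by (auto simp: atLeastAtMostSuc_conv)
  thus ?case using Suc step_measurable[of "Suc n" "k (Suc n)"] by (simp add: Int)
qed simp

lemma P_cylinder: "P {\<omega> \<in> \<Omega>. \<forall>i\<in>{1..n}. U i \<omega> = k i} = (\<Prod>i = 1..n. jump N c (k i))"
  unfolding independent by (intro prod.cong refl P_step) simp

text \<open>
  Independence is only given for cylinders. An event of the first \<open>n\<close> steps is the disjoint union of the
  cylinders over its histories, and there are finitely many of these because steps are bounded; so finite
  additivity extends the product rule to all such events.
\<close>

lemma P_past_and_step:
  fixes Q :: "(nat \<Rightarrow> int) \<Rightarrow> bool"
  defines "H n \<omega> \<equiv> restrict (\<lambda>i. U i \<omega>) {1..n}"
  shows "{\<omega> \<in> \<Omega>. Q (H n \<omega>) \<and> U (Suc n) \<omega> = k} \<in> \<A>"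
    and "P {\<omega> \<in> \<Omega>. Q (H n \<omega>) \<and> U (Suc n) \<omega> = k} = P {\<omega> \<in> \<Omega>. Q (H n \<omega>)} * jump N c k"
proof -
  define B where "B = {\<kappa> \<in> PiE {1..n} (\<lambda>_. {- int N..int N}). Q \<kappa>}"
  define C where "C \<kappa> = {\<omega> \<in> \<Omega>. \<forall>i\<in>{1..n}. U i \<omega> = \<kappa> i}" for \<kappa>
  define C' where "C' \<kappa> = {\<omega> \<in> \<Omega>. \<forall>i\<in>{1..Suc n}. U i \<omega> = (\<kappa>(Suc n := k)) i}" for \<kappa>
  have "finite (PiE {1..n} (\<lambda>_. {- int N..int N}))" by (rule finite_PiE) auto
  hence fin: "finite B" by (rule rev_finite_subset) (auto simp: B_def)
  have ext: "H n \<omega> = \<kappa>" if "\<kappa> \<in> B" "\<omega> \<in> C \<kappa>" for \<kappa> \<omega>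
    using that unfolding B_def C_def H_def by (auto simp: PiE_def extensional_def restrict_def)
  have memB: "H n \<omega> \<in> B" if "\<omega> \<in> \<Omega>" "Q (H n \<omega>)" for \<omega>
    using that step_range unfolding B_def H_def by (auto simp: restrict_def PiE_def extensional_def)
  have inC: "\<omega> \<in> C (H n \<omega>)" if "\<omega> \<in> \<Omega>" for \<omega> using that by (simp add: C_def H_def)
  have CC': "C' \<kappa> = C \<kappa> \<inter> {\<omega> \<in> \<Omega>. U (Suc n) \<omega> = k}" for \<kappa>
    unfolding C_def C'_def by (auto simp: atLeastAtMostSuc_conv)
  have un: "{\<omega> \<in> \<Omega>. Q (H n \<omega>)} = (\<Union>\<kappa>\<in>B. C \<kappa>)"
  proof (intro equalityI subsetI)
    fix \<omega> assume "\<omega> \<in> (\<Union>\<kappa>\<in>B. C \<kappa>)"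
    then obtain \<kappa> where "\<kappa> \<in> B" "\<omega> \<in> C \<kappa>" by blast
    with ext[OF this] show "\<omega> \<in> {\<omega> \<in> \<Omega>. Q (H n \<omega>)}" by (auto simp: B_def C_def)
  qed (use memB inC in blast)
  have un': "{\<omega> \<in> \<Omega>. Q (H n \<omega>) \<and> U (Suc n) \<omega> = k} = (\<Union>\<kappa>\<in>B. C' \<kappa>)"
    unfolding CC' using un by blast
  have dis: "disjoint_family_on C B" "disjoint_family_on C' B"
    unfolding disjoint_family_on_def CC' using ext by blast+
  have CA: "C \<kappa> \<in> \<A>" "C' \<kappa> \<in> \<A>" for \<kappa>
    unfolding C_def C'_def by (rule cylinder_measurable)+
  show "{\<omega> \<in> \<Omega>. Q (H n \<omega>) \<and> U (Suc n) \<omega> = k} \<in> \<A>"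
    unfolding un' using P_finite_UN(1)[OF fin] CA dis by auto
  have "P (C' \<kappa>) = P (C \<kappa>) * jump N c k" for \<kappa>
    unfolding C_def C'_def P_cylinder by simp
  thus "P {\<omega> \<in> \<Omega>. Q (H n \<omega>) \<and> U (Suc n) \<omega> = k} = P {\<omega> \<in> \<Omega>. Q (H n \<omega>)} * jump N c k"
    unfolding un un' P_finite_UN(2)[OF fin CA(1) dis(1)] P_finite_UN(2)[OF fin CA(2) dis(2)]
    by (simp add: sum_distrib_right)
qed

lemma P_interior_path_0: "P (interior_path \<Omega> U a b 0 y) = (if y = 0 then 1 else 0)"
  by (auto simp: interior_path_def walk_def total_mass P_empty)

text \<open>
  Decomposition over the position before the last step. The first step is covered as well, because the walk
  starts inside the interval.
\<close>

lemma P_interior_path_Suc: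
  assumes "a < 0" "0 < b"
  shows "P (interior_path \<Omega> U a b (Suc n) y)
    = (\<Sum>x\<in>{a<..<b}. jump N c (y - x) * P (interior_path \<Omega> U a b n x))"
proof -
  define Q where "Q x \<kappa> \<longleftrightarrow> (\<forall>j\<in>{1..<n}. (\<Sum>i = 1..j. \<kappa> i) \<in> {a<..<b}) \<and> (\<Sum>i = 1..n. \<kappa> i) = x"
    for x and \<kappa> :: "nat \<Rightarrow> int"
  have past: "interior_path \<Omega> U a b n x = {\<omega> \<in> \<Omega>. Q x (restrict (\<lambda>i. U i \<omega>) {1..n})}" for x
  proof -
    have "(\<Sum>i = 1..j. restrict (\<lambda>i. U i \<omega>) {1..n} i) = walk U j \<omega>" if "j \<le> n" for j \<omega>
      unfolding walk_def by (rule sum.cong) (use that in auto)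
    thus ?thesis by (auto simp: interior_path_def Q_def simp del: restrict_apply)
  qed
  define F where "F x = {\<omega> \<in> \<Omega>. Q x (restrict (\<lambda>i. U i \<omega>) {1..n}) \<and> U (Suc n) \<omega> = y - x}" for x
  have F: "F x = {\<omega> \<in> interior_path \<Omega> U a b n x. U (Suc n) \<omega> = y - x}" for x
    unfolding F_def past by auto
  have in_I: "walk U n \<omega> \<in> {a<..<b}" if "\<forall>j\<in>{1..<Suc n}. walk U j \<omega> \<in> {a<..<b}" for \<omega>
    using that assms by (cases "n = 0") (auto simp: walk_def)
  have "interior_path \<Omega> U a b (Suc n) y = (\<Union>x\<in>{a<..<b}. F x)"
  proof (intro equalityI subsetI)
    fix \<omega> assume \<omega>: "\<omega> \<in> interior_path \<Omega> U a b (Suc n) y"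
    hence "\<omega> \<in> F (walk U n \<omega>)" by (auto simp: F interior_path_def walk_def)
    thus "\<omega> \<in> (\<Union>x\<in>{a<..<b}. F x)" using in_I[of \<omega>] \<omega> by (auto simp: interior_path_def)
  next
    fix \<omega> assume "\<omega> \<in> (\<Union>x\<in>{a<..<b}. F x)"
    then obtain x where "x \<in> {a<..<b}" "\<omega> \<in> interior_path \<Omega> U a b n x" "U (Suc n) \<omega> = y - x"
      by (auto simp: F)
    thus "\<omega> \<in> interior_path \<Omega> U a b (Suc n) y"
      by (auto simp: interior_path_def walk_def less_Suc_eq)
  qed
  moreover have "disjoint_family_on F {a<..<b}"
    by (auto simp: disjoint_family_on_def F interior_path_def)
  moreover have "F x \<in> \<A>" for x unfolding F_def by (rule P_past_and_step(1))
  ultimately have "P (interior_path \<Omega> U a b (Suc n) y) = (\<Sum>x\<in>{a<..<b}. P (F x))"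
    using P_finite_UN(2)[of "{a<..<b}" F] by simp
  also have "\<dots> = (\<Sum>x\<in>{a<..<b}. jump N c (y - x) * P (interior_path \<Omega> U a b n x))"
    unfolding F_def past P_past_and_step(2) by (simp add: mult.commute)
  finally show ?thesis .
qed

end

lemma Inf_enat_eq_iff:
  "Inf {enat n | n. R n} = enat k \<longleftrightarrow> R k \<and> (\<forall>j<k. \<not> R j)"
proof
  assume eq: "Inf {enat n | n. R n} = enat k"
  hence ne: "{enat n | n. R n} \<noteq> {}" by (auto simp: Inf_enat_def split: if_splits)
  hence "Inf {enat n | n. R n} \<in> {enat n | n. R n}"
    unfolding Inf_enat_def by (simp only: if_False) (metis (mono_tags, lifting) LeastI ex_in_conv)
  hence "R k" using eq by auto
  moreover have "\<not> R j" if "j < k" for j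
  proof
    assume "R j"
    hence "Inf {enat n | n. R n} \<le> enat j" by (intro Inf_lower) auto
    with eq that show False by simp
  qed
  ultimately show "R k \<and> (\<forall>j<k. \<not> R j)" by blast
next
  assume R: "R k \<and> (\<forall>j<k. \<not> R j)"
  show "Inf {enat n | n. R n} = enat k"
  proof (rule antisym)
    show "Inf {enat n | n. R n} \<le> enat k" using R by (intro Inf_lower) auto
    show "enat k \<le> Inf {enat n | n. R n}" using R by (intro Inf_greatest) (auto simp: not_less[symmetric])
  qed
qed

lemma exit_prob_eq_interior_path:
  assumes "1 \<le> k" "l \<le> a \<or> b \<le> l"
  shows "exit_prob \<Omega> P U a b l k = P (interior_path \<Omega> U a b k l)"
proof -
  have "exit_time U a b \<omega> = enat k \<and> exit_place U a b \<omega> = l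
      \<longleftrightarrow> (\<forall>j\<in>{1..<k}. walk U j \<omega> \<in> {a<..<b}) \<and> walk U k \<omega> = l" for \<omega>
  proof -
    have "exit_time U a b \<omega> = enat k \<longleftrightarrow> (1 \<le> k \<and> (walk U k \<omega> \<le> a \<or> b \<le> walk U k \<omega>)) \<and>
        (\<forall>j<k. \<not> (1 \<le> j \<and> (walk U j \<omega> \<le> a \<or> b \<le> walk U j \<omega>)))"
      unfolding exit_time_def by (rule Inf_enat_eq_iff)
    moreover have "exit_place U a b \<omega> = walk U k \<omega>" if "exit_time U a b \<omega> = enat k"
      unfolding exit_place_def that by simp
    ultimately show ?thesis using assms by (auto simp: not_le)
  qed
  thus ?thesis unfolding exit_prob_def interior_path_def by simp
qed

section \<open>The generating function as a rational function\<close>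

text \<open>
  The \<open>\<ell>\<^sup>1\<close> norm of \<open>M n\<close> grows at most by the factor \<open>R\<close>, which dominates all column sums of the kernel.
\<close>

lemma kernel_iterates_summable:
  fixes M :: "nat \<Rightarrow> 'a \<Rightarrow> complex" and \<kappa> :: "'a \<Rightarrow> 'a \<Rightarrow> complex"
  assumes "finite I" and rec: "\<And>n y. y \<in> I \<Longrightarrow> M (Suc n) y = (\<Sum>x\<in>I. \<kappa> y x * M n x)"
  obtains r where "r > 0" "\<And>s y. cmod s < r \<Longrightarrow> y \<in> I \<Longrightarrow> summable (\<lambda>n. M n y * s ^ n)"
proof -
  define R where "R = 1 + (\<Sum>x\<in>I. \<Sum>y\<in>I. cmod (\<kappa> y x))"
  define m where "m n = (\<Sum>y\<in>I. cmod (M n y))" for n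
  have R: "R \<ge> 1" unfolding R_def by (simp add: sum_nonneg)
  have col: "(\<Sum>y\<in>I. cmod (\<kappa> y x)) \<le> R" if "x \<in> I" for x
  proof -
    have "(\<Sum>y\<in>I. cmod (\<kappa> y x)) \<le> (\<Sum>x\<in>I. \<Sum>y\<in>I. cmod (\<kappa> y x))"
      by (rule member_le_sum[OF that]) (auto intro: sum_nonneg assms(1))
    thus ?thesis by (simp add: R_def)
  qed
  have step: "m (Suc n) \<le> R * m n" for n
  proof -
    have "m (Suc n) = (\<Sum>y\<in>I. cmod (\<Sum>x\<in>I. \<kappa> y x * M n x))"
      unfolding m_def by (rule sum.cong) (simp_all add: rec)
    also have "\<dots> \<le> (\<Sum>y\<in>I. \<Sum>x\<in>I. cmod (\<kappa> y x) * cmod (M n x))"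
      by (intro sum_mono order_trans[OF norm_sum]) (simp add: norm_mult)
    also have "\<dots> = (\<Sum>x\<in>I. (\<Sum>y\<in>I. cmod (\<kappa> y x)) * cmod (M n x))"
      by (subst sum.swap) (simp add: sum_distrib_right)
    also have "\<dots> \<le> (\<Sum>x\<in>I. R * cmod (M n x))"
      by (intro sum_mono mult_right_mono col) auto
    finally show ?thesis by (simp add: m_def sum_distrib_left)
  qed
  have bound: "m n \<le> R ^ n * m 0" for n
  proof (induction n)
    case (Suc n)
    have "m (Suc n) \<le> R * (R ^ n * m 0)"
      using step[of n] mult_left_mono[OF Suc, of R] R by linarith
    thus ?case by (simp add: mult.assoc)
  qed simp
  have "summable (\<lambda>n. M n y * s ^ n)" if s: "cmod s < 1 / R" and y: "y \<in> I" for s y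
  proof (rule summable_comparison_test')
    show "summable (\<lambda>n. m 0 * (R * cmod s) ^ n)"
      using s R by (intro summable_mult summable_geometric) (simp add: field_simps)
    fix n
    have "cmod (M n y) \<le> m n" unfolding m_def by (rule member_le_sum[OF y]) (auto simp: assms(1))
    also have "\<dots> \<le> R ^ n * m 0" by (rule bound)
    finally have "cmod (M n y) * cmod s ^ n \<le> R ^ n * m 0 * cmod s ^ n" by (rule mult_right_mono) simp
    thus "norm (M n y * s ^ n) \<le> m 0 * (R * cmod s) ^ n"
      by (simp add: norm_mult norm_power power_mult_distrib mult_ac)
  qed
  with R show thesis by (intro that[of "1 / R"]) auto
qed

lemma exit_set_Un_interior:
  assumes "a < b" "1 \<le> N"
  shows "{a - int N + 1..b + int N - 1} = exit_set N a b \<union> {a<..<b}"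
    and "exit_set N a b \<inter> {a<..<b} = {}" and "finite (exit_set N a b)"
  using assms by (auto simp: exit_set_def)

text \<open>
  Optional stopping for \<open>s ^ n * u ^ S\<^sub>n\<close>, with \<open>h\<close> in the place of the Green function. Let \<open>g l\<close> be the
  summand at \<open>l\<close>. Over all points that one step from the interval can reach, the \<open>g l\<close> add up to
  \<open>(\<Sum>x. h x * u powi x)\<close>, since a step reproduces \<open>u powi x\<close> up to the factor \<open>1 / s\<close>; over the points of
  the interval, the equation for \<open>h\<close> makes them add up to the same quantity minus \<open>u powi 0\<close>.
\<close>

lemma exit_place_balance:
  fixes h :: "int \<Rightarrow> complex" and u s :: complex
  assumes "a < 0" "0 < b" "1 \<le> N" "u \<noteq> 0"
    and u: "s * (\<Sum>k\<in>{- int N..int N}. of_real (jump N c k) * u powi k) = 1"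
    and h: "\<And>y. y \<in> {a<..<b} \<Longrightarrow>
      h y = (if y = 0 then 1 else 0) + s * (\<Sum>x\<in>{a<..<b}. of_real (jump N c (y - x)) * h x)"
  shows "(\<Sum>l\<in>exit_set N a b. u powi l * (s * (\<Sum>x\<in>{a<..<b}. of_real (jump N c (l - x)) * h x))) = 1"
proof -
  define g where "g l = u powi l * (s * (\<Sum>x\<in>{a<..<b}. of_real (jump N c (l - x)) * h x))" for l
  note E = exit_set_Un_interior[of a b N]
  have ab: "a < b" using assms by simp
  have row: "s * (\<Sum>l\<in>{a - int N + 1..b + int N - 1}. u powi l * of_real (jump N c (l - x))) = u powi x"
    if x: "x \<in> {a<..<b}" for x
  proof -
    have "(\<Sum>l\<in>{a - int N + 1..b + int N - 1}. u powi l * of_real (jump N c (l - x)))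
        = (\<Sum>l\<in>{x - int N..x + int N}. u powi l * of_real (jump N c (l - x)))"
      by (rule sum.mono_neutral_right) (use x in \<open>auto intro!: jump_outside\<close>)
    also have "\<dots> = (\<Sum>k\<in>{- int N..int N}. u powi (x + k) * of_real (jump N c k))"
      by (rule sum.reindex_bij_witness[of _ "\<lambda>k. x + k" "\<lambda>y. y - x"]) auto
    also have "\<dots> = u powi x * (\<Sum>k\<in>{- int N..int N}. of_real (jump N c k) * u powi k)"
      using assms(4) by (simp add: power_int_add sum_distrib_left mult_ac)
    finally show ?thesis using u by (simp add: mult.left_commute)
  qed
  have "(\<Sum>l\<in>exit_set N a b. g l) + (\<Sum>y\<in>{a<..<b}. g y) = (\<Sum>l\<in>{a - int N + 1..b + int N - 1}. g l)"
    using E ab assms(3) by (simp add: sum.union_disjoint)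
  also have "\<dots> = (\<Sum>x\<in>{a<..<b}. h x * (s * (\<Sum>l\<in>{a - int N + 1..b + int N - 1}. u powi l * of_real (jump N c (l - x)))))"
    unfolding g_def sum_distrib_left by (subst sum.swap) (simp add: mult_ac)
  also have "\<dots> = (\<Sum>x\<in>{a<..<b}. h x * u powi x)"
    by (rule sum.cong) (simp_all only: row)
  finally have total: "(\<Sum>l\<in>exit_set N a b. g l) + (\<Sum>y\<in>{a<..<b}. g y) = (\<Sum>x\<in>{a<..<b}. h x * u powi x)" .
  have "(\<Sum>y\<in>{a<..<b}. g y) = (\<Sum>y\<in>{a<..<b}. h y * u powi y - (if y = 0 then 1 else 0))"
  proof (rule sum.cong)
    fix y assume "y \<in> {a<..<b}"
    from h[OF this] have "s * (\<Sum>x\<in>{a<..<b}. of_real (jump N c (y - x)) * h x) = h y - (if y = 0 then 1 else 0)"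
      by (metis add_diff_cancel_left')
    thus "g y = h y * u powi y - (if y = 0 then 1 else 0)" unfolding g_def by (auto simp: algebra_simps)
  qed simp
  also have "\<dots> = (\<Sum>y\<in>{a<..<b}. h y * u powi y) - 1"
    using assms by (simp add: sum_subtractf)
  finally show ?thesis using total unfolding g_def by simp
qed

text \<open>
  The quotient \<open>p l / d\<close> is the generating function of \<open>M (Suc k) l\<close> with exponent \<open>k\<close>, one less than the
  exit time; this keeps \<open>p l\<close> a plain combination of the Cramer numerators, and the missing factor \<open>s\<close> is
  restored in the balance identity.
\<close>

lemma rational_generating_functions:
  fixes M :: "nat \<Rightarrow> int \<Rightarrow> real"
  assumes ab: "a < 0" "0 < b" and N: "1 \<le> N" and c: "0 < c"
    and M0: "\<And>y. M 0 y = (if y = 0 then 1 else 0)"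
    and M_Suc: "\<And>n y. M (Suc n) y = (\<Sum>x\<in>{a<..<b}. jump N c (y - x) * M n x)"
  obtains d :: "complex poly" and p :: "int \<Rightarrow> complex poly" where
    "\<And>t. 0 \<le> t \<Longrightarrow> t < 1 \<Longrightarrow> poly d (of_real t) \<noteq> 0"
    "\<And>s. c * 4 ^ N \<le> 2 \<Longrightarrow> cmod s < 1 \<Longrightarrow> poly d s \<noteq> 0"
    "\<And>l. \<forall>\<^sub>F s in nhds 0. (\<lambda>k. of_real (M (Suc k) l) * s ^ k) sums (poly (p l) s / poly d s)"
    "\<And>s u. poly d s \<noteq> 0 \<Longrightarrow> u \<noteq> 0 \<Longrightarrow>
       s * (\<Sum>k\<in>{- int N..int N}. of_real (jump N c k) * u powi k) = 1 \<Longrightarrow>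
       (\<Sum>l\<in>exit_set N a b. u powi l * (s * (poly (p l) s / poly d s))) = 1"
proof -
  define \<kappa> where "\<kappa> y x = complex_of_real (jump N c (y - x))" for y x
  define e :: "int \<Rightarrow> complex" where "e y = (if y = 0 then 1 else 0)" for y
  obtain d Y where
    d0: "\<And>s. poly d s = 0 \<Longrightarrow>
      \<exists>f. (\<exists>x\<in>{a<..<b}. f x \<noteq> 0) \<and> (\<forall>x\<in>{a<..<b}. f x = s * (\<Sum>y\<in>{a<..<b}. \<kappa> x y * f y))"
    and cramer: "\<And>s h. \<forall>x\<in>{a<..<b}. h x = e x + s * (\<Sum>y\<in>{a<..<b}. \<kappa> x y * h y) \<Longrightarrow>
      \<forall>x\<in>{a<..<b}. h x * poly d s = poly (Y x) s"
    and sol: "\<And>s. poly d s \<noteq> 0 \<Longrightarrow> \<forall>x\<in>{a<..<b}. poly (Y x) s / poly d s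
      = e x + s * (\<Sum>y\<in>{a<..<b}. \<kappa> x y * (poly (Y y) s / poly d s))"
    using linear_system_cramer[where I = "{a<..<b}" and \<kappa> = \<kappa> and e = e, OF finite_greaterThanLessThan_int]
    by blast
  have nz: "poly d s \<noteq> 0" if s: "(\<exists>t. 0 \<le> t \<and> t < 1 \<and> s = of_real t) \<or> (cmod s < 1 \<and> c * 4 ^ N \<le> 2)" for s
  proof
    assume "poly d s = 0"
    then obtain f x where f: "x \<in> {a<..<b}" "f x \<noteq> 0"
      "\<And>x. x \<in> {a<..<b} \<Longrightarrow> f x = s * (\<Sum>y\<in>{a<..<b}. \<kappa> x y * f y)"
      using d0 by blast
    \<comment> \<open>The Green function uses the transposed kernel, but the law of a step is symmetric.\<close>
    have "\<kappa> x y = of_real (jump N c (y - x))" for x y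
      using jump_uminus[of N c "x - y"] by (simp add: \<kappa>_def)
    with killed_kernel_no_eigenfunction[of a b f s N c x] f c s show False by simp
  qed
  define p where "p l = (\<Sum>x\<in>{a<..<b}. Polynomial.smult (of_real (jump N c (l - x))) (Y x))" for l
  have p: "poly (p l) s / poly d s = (\<Sum>x\<in>{a<..<b}. of_real (jump N c (l - x)) * (poly (Y x) s / poly d s))" for l s
    by (simp add: p_def poly_sum sum_divide_distrib)
  have "\<forall>\<^sub>F s in nhds 0. (\<lambda>k. of_real (M (Suc k) l) * s ^ k) sums (poly (p l) s / poly d s)" for l
  proof -
    have "of_real (M (Suc n) y) = (\<Sum>x\<in>{a<..<b}. \<kappa> y x * of_real (M n x))" for n y
      by (simp add: M_Suc \<kappa>_def)
    then obtain r where r: "r > 0"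
      "\<And>s y. cmod s < r \<Longrightarrow> y \<in> {a<..<b} \<Longrightarrow> summable (\<lambda>n. of_real (M n y) * s ^ n)"
      using kernel_iterates_summable[of "{a<..<b}" "\<lambda>n y. of_real (M n y)" \<kappa>] by auto
    have "open {s. poly d s \<noteq> 0}" by (intro open_Collect_neq continuous_intros)
    moreover have "poly d 0 \<noteq> 0" using nz[of 0] by auto
    ultimately have "\<forall>\<^sub>F s in nhds 0. s \<in> {s. poly d s \<noteq> 0}" by (intro eventually_nhds_in_open) auto
    moreover have "\<forall>\<^sub>F s in nhds 0. s \<in> ball (0 :: complex) r"
      using r(1) by (intro eventually_nhds_in_open) auto
    ultimately show ?thesis
    proof eventually_elim
      case (elim s)
      \<comment> \<open>The sum of the series solves the linear system, so Cramer's rule gives its value.\<close>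
      define h where "h y = (\<Sum>n. complex_of_real (M n y) * s ^ n)" for y
      have sum_h: "(\<lambda>n. complex_of_real (M n y) * s ^ n) sums h y" if "y \<in> {a<..<b}" for y
        unfolding h_def using r(2)[OF _ that, of s] elim(2) by (intro summable_sums) auto
      have tail: "(\<lambda>n. of_real (M (Suc n) y) * s ^ n) sums (\<Sum>x\<in>{a<..<b}. \<kappa> y x * h x)" for y
      proof -
        have "(\<lambda>n. \<Sum>x\<in>{a<..<b}. \<kappa> y x * (of_real (M n x) * s ^ n)) sums (\<Sum>x\<in>{a<..<b}. \<kappa> y x * h x)"
          by (intro sums_sum sums_mult sum_h)
        moreover have "of_real (M (Suc n) y) * s ^ n = (\<Sum>x\<in>{a<..<b}. \<kappa> y x * (of_real (M n x) * s ^ n))" for n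
          by (simp add: M_Suc \<kappa>_def sum_distrib_right mult.assoc)
        ultimately show ?thesis by (simp only:)
      qed
      have "h y = e y + s * (\<Sum>x\<in>{a<..<b}. \<kappa> y x * h x)" if y: "y \<in> {a<..<b}" for y
      proof -
        have "(\<lambda>n. of_real (M (Suc n) y) * s ^ Suc n) sums (s * (\<Sum>x\<in>{a<..<b}. \<kappa> y x * h x))"
          using sums_mult[OF tail[of y], of s] by (simp add: mult_ac)
        from sums_Suc[OF this] have "(\<lambda>n. of_real (M n y) * s ^ n) sums (s * (\<Sum>x\<in>{a<..<b}. \<kappa> y x * h x) + e y)"
          by (cases "y = 0") (simp_all add: M0 e_def)
        from sums_unique2[OF sum_h[OF y] this] show ?thesis by simp
      qed
      with cramer[of h s] have "\<forall>x\<in>{a<..<b}. h x * poly d s = poly (Y x) s" by blast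
      hence "\<forall>x\<in>{a<..<b}. poly (Y x) s / poly d s = h x" using elim(1) by (auto simp: field_simps)
      hence "(\<Sum>x\<in>{a<..<b}. \<kappa> l x * h x) = poly (p l) s / poly d s"
        unfolding p \<kappa>_def by (intro sum.cong) auto
      with tail[of l] show ?case by simp
    qed
  qed
  moreover have "(\<Sum>l\<in>exit_set N a b. u powi l * (s * (poly (p l) s / poly d s))) = 1"
    if "poly d s \<noteq> 0" "u \<noteq> 0" "s * (\<Sum>k\<in>{- int N..int N}. of_real (jump N c k) * u powi k) = 1" for s u
    unfolding p
    by (rule exit_place_balance[OF ab N that(2,3)]) (use sol[OF that(1)] in \<open>unfold e_def \<kappa>_def, blast\<close>)
  ultimately show thesis using that[of d p] nz by blast
qed

section \<open>Cramer's rule for the exit places\<close>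

text \<open>
  Testing the relation against the polynomial that vanishes at all nodes except \<open>u i\<close> isolates \<open>\<beta> i\<close>.
\<close>

lemma vandermonde_independent:
  fixes u \<beta> :: "'i \<Rightarrow> 'a::field"
  assumes "finite S" "inj_on u S" "\<And>m. m < card S \<Longrightarrow> (\<Sum>i\<in>S. \<beta> i * u i ^ m) = 0" "i \<in> S"
  shows "\<beta> i = 0"
proof -
  define q where "q = (\<Prod>k\<in>S - {i}. [:- u k, 1:])"
  have "degree q \<le> (\<Sum>k\<in>S - {i}. degree [:- u k, 1:])"
    unfolding q_def using degree_prod_sum_le[of "S - {i}" "\<lambda>k. [:- u k, 1:]"] assms(1)
    by (simp add: o_def)
  also have "\<dots> = card S - 1" using assms(1,4) by simp
  also have "\<dots> < card S" using assms(1,4) by (intro diff_less) (auto simp: card_gt_0_iff)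
  finally have deg: "degree q < card S" .
  have "(\<Sum>k\<in>S. \<beta> k * poly q (u k)) = (\<Sum>m\<le>degree q. coeff q m * (\<Sum>k\<in>S. \<beta> k * u k ^ m))"
    unfolding poly_altdef sum_distrib_left by (subst sum.swap) (simp add: mult_ac)
  also have "\<dots> = 0" using assms(3) deg by (intro sum.neutral) auto
  finally have "(\<Sum>k\<in>S. \<beta> k * poly q (u k)) = 0" .
  moreover have "(\<Sum>k\<in>S. \<beta> k * poly q (u k)) = \<beta> i * poly q (u i)"
  proof -
    have "poly q (u k) = 0" if "k \<in> S - {i}" for k
      using assms(1) that by (auto simp: q_def poly_prod)
    thus ?thesis using assms(1,4) by (subst sum.remove[of S i]) auto
  qed
  moreover have "poly q (u i) \<noteq> 0"
    using assms(1,2,4) by (auto simp: q_def poly_prod inj_on_def)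
  ultimately show ?thesis by simp
qed

definition exit_place_of_column :: "nat \<Rightarrow> int \<Rightarrow> int \<Rightarrow> nat \<Rightarrow> int" where
  "exit_place_of_column N a b j = col_exponent N a b j - (int N - a - 1)"

lemma exit_place_of_column_eq: "exit_place_of_column N a b j = (if j < N then a - int N + 1 + int j else b + int j - int N)"
  by (simp add: exit_place_of_column_def col_exponent_def)

lemma bij_betw_exit_place_of_column:
  assumes "a < b"
  shows "bij_betw (exit_place_of_column N a b) {..<2 * N} (exit_set N a b)"
proof (rule bij_betw_byWitness[where f' = "\<lambda>l. if l \<le> a then nat (l + int N - a - 1) else nat (l - b + int N)"])
  show "\<forall>j\<in>{..<2 * N}. (if exit_place_of_column N a b j \<le> a then nat (exit_place_of_column N a b j + int N - a - 1)
      else nat (exit_place_of_column N a b j - b + int N)) = j"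
    using assms by (simp add: exit_place_of_column_eq)
  show "\<forall>l\<in>exit_set N a b. exit_place_of_column N a b (if l \<le> a then nat (l + int N - a - 1)
      else nat (l - b + int N)) = l"
    using assms by (auto simp: exit_place_of_column_eq exit_set_def)
  show "exit_place_of_column N a b ` {..<2 * N} \<subseteq> exit_set N a b"
    by (auto simp: exit_place_of_column_eq exit_set_def)
  show "(\<lambda>l. if l \<le> a then nat (l + int N - a - 1) else nat (l - b + int N)) ` exit_set N a b \<subseteq> {..<2 * N}"
    using assms by (auto simp: exit_set_def)
qed

text \<open>
  The first factor depends on the row only: the matrix of \<open>W_det\<close> is the matrix of the powers \<open>u i powi l\<close>,
  for \<open>l\<close> in the exit set, with its rows scaled so that all exponents become nonnegative.
\<close>

lemma power_col_exponent:
  fixes u :: complex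
  assumes "u \<noteq> 0" "a < 0" "0 < b"
  shows "u ^ nat (col_exponent N a b j) = u powi (int N - a - 1) * u powi exit_place_of_column N a b j"
proof -
  have "0 \<le> col_exponent N a b j" using assms by (auto simp: col_exponent_def)
  hence "u ^ nat (col_exponent N a b j) = u powi col_exponent N a b j"
    by (simp add: power_int_def)
  also have "\<dots> = u powi ((int N - a - 1) + exit_place_of_column N a b j)" by (simp add: exit_place_of_column_def)
  also have "\<dots> = u powi (int N - a - 1) * u powi exit_place_of_column N a b j"
    using assms(1) by (intro power_int_add) simp
  finally show ?thesis .
qed

lemma power_int_add_of_nat:
  fixes u :: "'a::field"
  shows "u \<noteq> 0 \<Longrightarrow> u powi (k + int m) = u powi k * u ^ m"
  by (simp add: power_int_add)

text \<open>
  A relation between the rows is a function \<open>h x = (\<Sum>i. w i * u i powi x)\<close> vanishing on the exit set. Each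
  exponential solves the equation of the walk without killing, and as \<open>h\<close> is zero outside the interval
  (within reach of one step) it solves the killed one; so it vanishes inside as well, giving at least
  \<open>2 * N\<close> consecutive zeros.
\<close>

lemma W_det_nonzero:
  assumes N: "1 \<le> N" and c: "0 < c" and ab: "a < 0" "0 < b" and z: "0 < z" "z < 1"
    and u: "inj_on u {1..2 * N}" "\<And>i. i \<in> {1..2 * N} \<Longrightarrow> u i \<noteq> 0"
      "\<And>i. i \<in> {1..2 * N} \<Longrightarrow> of_real z * (\<Sum>k\<in>{- int N..int N}. of_real (jump N c k) * u i powi k) = 1"
  shows "W_det N a b u \<noteq> 0"
proof
  define A where "A = Matrix.mat (2 * N) (2 * N) (\<lambda>(i, j). u (i + 1) ^ nat (col_exponent N a b j))"
  have A: "A \<in> carrier_mat (2 * N) (2 * N)" by (simp add: A_def)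
  assume "W_det N a b u = 0"
  hence "Determinant.det (transpose_mat A) = 0" using det_transpose[OF A] by (simp add: W_det_def A_def)
  then obtain v where v: "v \<in> carrier_vec (2 * N)" "v \<noteq> 0\<^sub>v (2 * N)" "transpose_mat A *\<^sub>v v = 0\<^sub>v (2 * N)"
    using det_0_iff_vec_prod_zero_field[of "transpose_mat A" "2 * N"] A by auto
  \<comment> \<open>The weights absorb the row scaling of \<open>power_col_exponent\<close>.\<close>
  define w where "w i = vec_index v i * u (i + 1) powi (int N - a - 1)" for i
  define h where "h x = (\<Sum>i<2 * N. w i * u (i + 1) powi x)" for x
  have u': "u (i + 1) \<noteq> 0" if "i < 2 * N" for i using u(2)[of "i + 1"] that by simp
  have h_exit: "h l = 0" if l: "l \<in> exit_set N a b" for l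
  proof -
    obtain j where j: "j < 2 * N" "l = exit_place_of_column N a b j"
      using bij_betw_exit_place_of_column[of a b N] ab l unfolding bij_betw_def by auto
    have "h l = (\<Sum>i<2 * N. u (i + 1) ^ nat (col_exponent N a b j) * vec_index v i)"
      unfolding h_def w_def j(2)
      by (intro sum.cong refl, subst power_col_exponent[OF _ ab]) (use u' in \<open>simp_all add: mult_ac\<close>)
    also have "\<dots> = vec_index (transpose_mat A *\<^sub>v v) j"
      using j(1) v(1) by (simp add: A_def scalar_prod_def atLeast0LessThan)
    finally show ?thesis using v(3) j(1) by simp
  qed
  have h_step: "h x = of_real z * (\<Sum>y\<in>{a<..<b}. of_real (jump N c (y - x)) * h y)"
    if x: "x \<in> {a<..<b}" for x
  proof -
    have "h x = (\<Sum>i<2 * N. w i * u (i + 1) powi x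
        * (of_real z * (\<Sum>k\<in>{- int N..int N}. of_real (jump N c k) * u (i + 1) powi k)))"
      unfolding h_def by (intro sum.cong refl) (use u(3) in simp)
    also have "\<dots> = (\<Sum>i<2 * N. of_real z * (\<Sum>k\<in>{- int N..int N}. of_real (jump N c k) * (w i * u (i + 1) powi (x + k))))"
      unfolding sum_distrib_left
      by (intro sum.cong refl) (use u' in \<open>simp add: power_int_add mult_ac\<close>)
    also have "\<dots> = of_real z * (\<Sum>k\<in>{- int N..int N}. of_real (jump N c k) * h (x + k))"
      unfolding h_def sum_distrib_left by (rule sum.swap)
    also have "(\<Sum>k\<in>{- int N..int N}. of_real (jump N c k) * h (x + k))
        = (\<Sum>y\<in>{x - int N..x + int N}. of_real (jump N c (y - x)) * h y)"
      by (rule sum.reindex_bij_witness[of _ "\<lambda>y. y - x" "\<lambda>k. x + k"]) auto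
    also have "\<dots> = (\<Sum>y\<in>{a - int N + 1..b + int N - 1}. of_real (jump N c (y - x)) * h y)"
      by (rule sum.mono_neutral_left) (use x in \<open>auto intro!: jump_outside\<close>)
    also have "\<dots> = (\<Sum>y\<in>{a<..<b}. of_real (jump N c (y - x)) * h y)"
      using exit_set_Un_interior(1,3)[of a b N] ab N h_exit
      by (intro sum.mono_neutral_right) auto
    finally show ?thesis .
  qed
  have "h x = 0" if "x \<in> {a<..<b}" for x
    by (rule killed_kernel_no_eigenfunction[OF h_step c _ that]) (use z in auto)
  hence h0: "h x = 0" if "x \<in> {a - int N + 1..b + int N - 1}" for x
    using that h_exit exit_set_Un_interior(1)[of a b N] ab N by auto
  have "v = 0\<^sub>v (2 * N)"
  proof (rule eq_vecI)
    fix i assume "i < dim_vec (0\<^sub>v (2 * N) :: complex vec)"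
    hence i: "i < 2 * N" by simp
    have "inj_on (\<lambda>i. u (i + 1)) {..<2 * N}"
      by (rule inj_onI) (use inj_onD[OF u(1), of "_ + 1" "_ + 1"] in simp)
    moreover have "(\<Sum>i<2 * N. w i * u (i + 1) powi (a - int N + 1) * u (i + 1) ^ m) = 0"
      if "m < 2 * N" for m
    proof -
      have "u (i + 1) powi (a - int N + 1 + int m) = u (i + 1) powi (a - int N + 1) * u (i + 1) ^ m"
        if "i < 2 * N" for i
        by (rule power_int_add_of_nat[OF u'[OF that]])
      hence "(\<Sum>i<2 * N. w i * u (i + 1) powi (a - int N + 1) * u (i + 1) ^ m) = h (a - int N + 1 + int m)"
        unfolding h_def by (intro sum.cong refl) (simp add: mult.assoc)
      also have "\<dots> = 0" using that ab by (intro h0) auto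
      finally show ?thesis .
    qed
    ultimately have "w i * u (i + 1) powi (a - int N + 1) = 0"
      using vandermonde_independent[of "{..<2 * N}" "\<lambda>i. u (i + 1)" "\<lambda>i. w i * u (i + 1) powi (a - int N + 1)" i] i
      by simp
    thus "vec_index v i = vec_index (0\<^sub>v (2 * N)) i" using u'[OF i] i by (simp add: w_def)
  qed (use v in simp)
  with v(2) show False by simp
qed

text \<open>
  The balance equations form a linear system for the values \<open>G l\<close>. In row \<open>i\<close>, scaled by
  \<open>u i powi (N - a - 1)\<close>, the constant side 1 becomes the column that replaces column \<open>l\<close> in \<open>W_det_repl\<close>.
\<close>

lemma W_det_repl_eq:
  fixes G :: "int \<Rightarrow> complex"
  assumes ab: "a < 0" "0 < b" and u: "\<And>i. i \<in> {1..2 * N} \<Longrightarrow> u i \<noteq> 0"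
    and bal: "\<And>i. i \<in> {1..2 * N} \<Longrightarrow> (\<Sum>l\<in>exit_set N a b. u i powi l * G l) = 1"
    and l: "l \<in> exit_set N a b"
  shows "W_det_repl N a b l u = G l * W_det N a b u"
proof -
  define A where "A = Matrix.mat (2 * N) (2 * N) (\<lambda>(i, j). u (i + 1) ^ nat (col_exponent N a b j))"
  have A: "A \<in> carrier_mat (2 * N) (2 * N)" by (simp add: A_def)
  have bij: "bij_betw (exit_place_of_column N a b) {..<2 * N} (exit_set N a b)"
    using ab by (intro bij_betw_exit_place_of_column) simp
  obtain j where j: "j < 2 * N" "l = exit_place_of_column N a b j"
    using bij l unfolding bij_betw_def by auto
  define x where "x = Matrix.vec (2 * N) (\<lambda>j. G (exit_place_of_column N a b j))"
  have Ax: "A *\<^sub>v x = Matrix.vec (2 * N) (\<lambda>i. u (i + 1) ^ nat (int N - a - 1))"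
  proof (rule eq_vecI)
    fix i assume "i < dim_vec (Matrix.vec (2 * N) (\<lambda>i. u (i + 1) ^ nat (int N - a - 1)))"
    hence i: "i < 2 * N" by simp
    hence ui: "u (i + 1) \<noteq> 0" using u[of "i + 1"] by simp
    have "vec_index (A *\<^sub>v x) i = (\<Sum>j<2 * N. u (i + 1) ^ nat (col_exponent N a b j) * G (exit_place_of_column N a b j))"
      using i by (simp add: A_def x_def scalar_prod_def atLeast0LessThan)
    also have "\<dots> = u (i + 1) powi (int N - a - 1) *
        (\<Sum>j<2 * N. u (i + 1) powi exit_place_of_column N a b j * G (exit_place_of_column N a b j))"
      unfolding power_col_exponent[OF ui ab] by (simp add: sum_distrib_left mult.assoc)
    also have "(\<Sum>j<2 * N. u (i + 1) powi exit_place_of_column N a b j * G (exit_place_of_column N a b j)) = 1"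
      using sum.reindex_bij_betw[OF bij, of "\<lambda>l. u (i + 1) powi l * G l"] bal[of "i + 1"] i by simp
    also have "u (i + 1) powi (int N - a - 1) * 1 = u (i + 1) ^ nat (int N - a - 1)"
      using ab by (simp add: power_int_def)
    finally show "vec_index (A *\<^sub>v x) i = vec_index (Matrix.vec (2 * N) (\<lambda>i. u (i + 1) ^ nat (int N - a - 1))) i"
      using i by simp
  qed (simp add: A_def)
  have col: "col_exponent N a b k = l + int N - a - 1 \<longleftrightarrow> k = j" if "k < 2 * N" for k
  proof -
    have "col_exponent N a b k = l + int N - a - 1 \<longleftrightarrow> exit_place_of_column N a b k = exit_place_of_column N a b j"
      by (auto simp: j(2) exit_place_of_column_def)
    also have "\<dots> \<longleftrightarrow> k = j" using bij that j(1) unfolding bij_betw_def inj_on_def by auto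
    finally show ?thesis .
  qed
  have "W_det_repl N a b l u = Determinant.det (replace_col A (A *\<^sub>v x) j)"
    unfolding W_det_repl_def Ax
    by (rule arg_cong[where f = Determinant.det], rule eq_matI) (auto simp: A_def replace_col_def col)
  also have "\<dots> = G l * W_det N a b u"
    using cramer_lemma_mat[OF A _ j(1), of x] j by (simp add: x_def W_det_def A_def)
  finally show ?thesis .
qed

section \<open>The exit distribution\<close>

lemma energy_threshold:
  assumes "1 \<le> N" "c \<le> 1 / 2 ^ (2 * N - 1)"
  shows "c * 4 ^ N \<le> (2::real)"
proof -
  have "(4::real) ^ N = 2 ^ (2 * N)" by (simp add: power_mult)
  also have "2 * N = Suc (2 * N - 1)" using assms(1) by simp
  finally have "(4::real) ^ N = 2 * 2 ^ (2 * N - 1)" by simp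
  thus ?thesis using assms(2) by (simp add: field_simps)
qed

text \<open>
  At \<open>s = z\<close> the rational generating function satisfies the balance equations of all \<open>2 * N\<close> characteristic
  roots, so Cramer's rule identifies its value. Only regularity remains: the zeros of \<open>d\<close> avoid the segment
  from 0 to \<open>z\<close>, and for small \<open>c\<close> the whole open unit disc.
\<close>

lemma exit_generating_function:
  assumes N: "1 \<le> N" and c: "0 < c" and ab: "a < 0" "0 < b"
    and walk: "pseudo_random_walk \<Omega> \<A> P U N c"
    and z: "z \<in> {0<..<1}" and l: "l \<in> exit_set N a b"
  shows "W_det N a b (char_root N c z) \<noteq> 0"
    and "continued_sum (exit_prob \<Omega> P U a b l) z
      (W_det_repl N a b l (char_root N c z) / W_det N a b (char_root N c z))"
    and "summable (\<lambda>k. exit_prob \<Omega> P U a b l (Suc k) * z ^ Suc k) \<Longrightarrow>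
      complex_of_real (\<Sum>k. exit_prob \<Omega> P U a b l (Suc k) * z ^ Suc k)
        = W_det_repl N a b l (char_root N c z) / W_det N a b (char_root N c z)"
    and "c \<le> 1 / 2 ^ (2 * N - 1) \<Longrightarrow> summable (\<lambda>k. exit_prob \<Omega> P U a b l (Suc k) * z ^ Suc k)"
proof -
  interpret pseudo_random_walk \<Omega> \<A> P U N c by (rule walk)
  let ?u = "char_root N c z"
  have z': "0 < z" "z < 1" using z by auto
  define q where "q = exit_prob \<Omega> P U a b l"
  define M where "M n y = P (interior_path \<Omega> U a b n y)" for n y
  have qM: "q (Suc k) = M (Suc k) l" for k
    unfolding q_def M_def by (rule exit_prob_eq_interior_path) (use l in \<open>auto simp: exit_set_def\<close>)
  obtain d p where
    d_real: "\<And>t. 0 \<le> t \<Longrightarrow> t < 1 \<Longrightarrow> poly d (of_real t) \<noteq> 0" and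
    d_disc: "\<And>s. c * 4 ^ N \<le> 2 \<Longrightarrow> cmod s < 1 \<Longrightarrow> poly d s \<noteq> 0" and
    series: "\<And>l. \<forall>\<^sub>F s in nhds 0. (\<lambda>k. of_real (M (Suc k) l) * s ^ k) sums (poly (p l) s / poly d s)" and
    balance: "\<And>s u. poly d s \<noteq> 0 \<Longrightarrow> u \<noteq> 0 \<Longrightarrow>
       s * (\<Sum>k\<in>{- int N..int N}. of_real (jump N c k) * u powi k) = 1 \<Longrightarrow>
       (\<Sum>l\<in>exit_set N a b. u powi l * (s * (poly (p l) s / poly d s))) = 1"
    using rational_generating_functions[of a b N c M] ab N c
      P_interior_path_0 P_interior_path_Suc[OF ab] unfolding M_def by blast
  have ser: "\<forall>\<^sub>F s in nhds 0. (\<lambda>k. of_real (q (Suc k)) * s ^ k) sums (poly (p l) s / poly d s)"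
    unfolding qM by (rule series)
  have dz: "poly d (of_real z) \<noteq> 0" using d_real z' by simp
  have "poly d (complex_of_real 0) \<noteq> 0" by (rule d_real) auto
  hence d0: "poly d 0 \<noteq> 0" by simp
  show W: "W_det N a b ?u \<noteq> 0"
    by (rule W_det_nonzero[OF N c ab z' char_root_inj[OF N c z'] char_root_nonzero[OF N c z']
        char_root_symbol[OF N c z']])
  have u0: "?u i \<noteq> 0" if "i \<in> {1..2 * N}" for i
    by (rule char_root_nonzero[OF N c z' that])
  have bal: "(\<Sum>l\<in>exit_set N a b. ?u i powi l * (of_real z * (poly (p l) (of_real z) / poly d (of_real z)))) = 1"
    if "i \<in> {1..2 * N}" for i
    by (rule balance[OF dz u0[OF that] char_root_symbol[OF N c z' that]])
  have "W_det_repl N a b l ?u = of_real z * (poly (p l) (of_real z) / poly d (of_real z)) * W_det N a b ?u"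
    by (rule W_det_repl_eq[OF ab u0 bal l])
  hence val: "W_det_repl N a b l ?u / W_det N a b ?u
      = of_real z * (poly (p l) (of_real z) / poly d (of_real z))"
    using W by simp
  show "continued_sum (exit_prob \<Omega> P U a b l) z (W_det_repl N a b l ?u / W_det N a b ?u)"
  proof -
    define S where "S = {s. poly d s \<noteq> 0}"
    define G where "G s = s * (poly (p l) s / poly d s)" for s
    \<comment> \<open>The component is open and connected, and it contains every connected subset of \<open>S\<close> through 0.\<close>
    define D where "D = connected_component_set S 0"
    have "open S" unfolding S_def by (intro open_Collect_neq continuous_intros)
    hence D: "open D" "connected D" "D \<subseteq> S"
      unfolding D_def by (auto intro: open_connected_component dest: connected_component_in)
    have "closed_segment 0 (complex_of_real z) \<subseteq> S"
    proof
      fix s assume "s \<in> closed_segment 0 (complex_of_real z)"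
      then obtain t where t: "0 \<le> t" "t \<le> 1" "s = of_real (t * z)"
        by (auto simp: closed_segment_def scaleR_conv_of_real)
      have "t * z \<le> 1 * z" using t z' by (intro mult_right_mono) auto
      hence "t * z < 1" using z' by linarith
      thus "s \<in> S" using t z' d_real[of "t * z"] by (simp add: S_def)
    qed
    hence "closed_segment 0 (complex_of_real z) \<subseteq> D"
      unfolding D_def by (intro connected_component_maximal) auto
    moreover have "G holomorphic_on D"
      unfolding G_def using D(3) by (auto intro!: holomorphic_intros simp: S_def)
    moreover have "\<forall>\<^sub>F s in nhds 0. (\<lambda>k. complex_of_real (q (Suc k)) * s ^ Suc k) sums G s"
      using ser
    proof eventually_elim
      case (elim s)
      from sums_mult[OF this, of s] show ?case by (simp add: G_def mult_ac)
    qed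
    ultimately show ?thesis
      unfolding continued_sum_def q_def[symmetric] val using D(1,2)
      by (intro exI[of _ D] exI[of _ G]) (simp add: G_def)
  qed
  have shift: "(\<lambda>k. complex_of_real (q (Suc k)) * of_real z ^ k)
      = (\<lambda>k. of_real (q (Suc k) * z ^ Suc k) / of_real z)"
    using z' by (intro ext) simp
  show "complex_of_real (\<Sum>k. exit_prob \<Omega> P U a b l (Suc k) * z ^ Suc k)
      = W_det_repl N a b l ?u / W_det N a b ?u"
    if sm: "summable (\<lambda>k. exit_prob \<Omega> P U a b l (Suc k) * z ^ Suc k)"
  proof -
    have sm': "summable (\<lambda>k. complex_of_real (q (Suc k) * z ^ Suc k))"
      using sm unfolding q_def[symmetric] by (rule summable_of_real)
    hence "summable (\<lambda>k. complex_of_real (q (Suc k)) * of_real z ^ k)"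
      unfolding shift by (rule summable_divide)
    from suminf_eq_rational_value[OF ser d0 dz this]
    have "(\<Sum>k. complex_of_real (q (Suc k) * z ^ Suc k)) / of_real z
        = poly (p l) (of_real z) / poly d (of_real z)"
      unfolding shift suminf_divide[OF sm'] .
    hence "(\<Sum>k. complex_of_real (q (Suc k) * z ^ Suc k))
        = of_real z * (poly (p l) (of_real z) / poly d (of_real z))"
      using z' by (simp add: field_simps)
    thus ?thesis unfolding val q_def[symmetric]
      using suminf_of_real[OF sm[folded q_def], where 'a = complex] by simp
  qed
  show "summable (\<lambda>k. exit_prob \<Omega> P U a b l (Suc k) * z ^ Suc k)" if "c \<le> 1 / 2 ^ (2 * N - 1)"
  proof -
    have "(\<lambda>s. poly (p l) s / poly d s) holomorphic_on ball 0 1"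
      using d_disc[OF energy_threshold[OF N that]] by (auto intro!: holomorphic_intros)
    from summable_of_holomorphic_ball[OF ser this, of "of_real z"] z'
    have "summable (\<lambda>k. complex_of_real (q (Suc k)) * of_real z ^ k)" by simp
    hence "summable (\<lambda>k. complex_of_real z * (complex_of_real (q (Suc k)) * of_real z ^ k))"
      by (rule summable_mult)
    hence "summable (\<lambda>k. complex_of_real (q (Suc k) * z ^ Suc k))" by (simp add: mult_ac)
    thus ?thesis unfolding q_def[symmetric] by (simp only: summable_of_real_iff)
  qed
qed

theorem theorem8p1:
  fixes N :: nat and c :: real and a b :: int
    and \<Omega> :: "'w set" and \<A> :: "'w set set" and P :: "'w set \<Rightarrow> real" and U :: "nat \<Rightarrow> 'w \<Rightarrow> int"
  assumes "1 \<le> N" and "0 < c" and "a < 0" and "0 < b"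
    and "pseudo_random_walk \<Omega> \<A> P U N c"
  shows
    "(\<forall>z\<in>{0<..<1}. \<forall>l\<in>exit_set N a b.
        W_det N a b (char_root N c z) \<noteq> 0 \<and>
        continued_sum (exit_prob \<Omega> P U a b l) z
          (W_det_repl N a b l (char_root N c z) / W_det N a b (char_root N c z)) \<and>
        (summable (\<lambda>k. exit_prob \<Omega> P U a b l (Suc k) * z ^ Suc k) \<longrightarrow>
          complex_of_real (\<Sum>k. exit_prob \<Omega> P U a b l (Suc k) * z ^ Suc k) =
            W_det_repl N a b l (char_root N c z) / W_det N a b (char_root N c z)) \<and>
        (c \<le> 1 / 2 ^ (2 * N - 1) \<longrightarrow>
          summable (\<lambda>k. exit_prob \<Omega> P U a b l (Suc k) * z ^ Suc k))) \<and>
     (\<forall>l\<in>exit_set N a b. \<forall>q :: nat \<Rightarrow> real.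
        (\<forall>z\<in>{0<..<1}. continued_sum q z
          (W_det_repl N a b l (char_root N c z) / W_det N a b (char_root N c z))) \<longrightarrow>
        (\<forall>k\<ge>1. q k = exit_prob \<Omega> P U a b l k))"
proof (intro conjI ballI allI impI)
  fix l and k :: nat and q :: "nat \<Rightarrow> real"
  assume l: "l \<in> exit_set N a b" and k: "1 \<le> k"
    and q: "\<forall>z\<in>{0<..<1}. continued_sum q z
      (W_det_repl N a b l (char_root N c z) / W_det N a b (char_root N c z))"
  show "q k = exit_prob \<Omega> P U a b l k"
    by (rule continued_sum_determines_coefficients[OF _ exit_generating_function(2)[OF assms _ l] k])
       (use q in auto)
qed (use exit_generating_function[OF assms] in blast)+

end
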